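(* Let $G$ be a finite group and $H\le G$ an abelian subgroup. Let $D$ be a set of double coset representatives for $H\backslash G/H$. The left-invariant random walk on $G$ driven by an irreducible weight $w$ lumps weakly to the left cosets of $H$ if and only if there exists a subset $P\subseteq\widehat{H}$ containing $\mathbb{1}_H$ such that $w\in\bigcap_{x\in D}W_x^\perp$, where \[ W_x=\bigl\langle e_\beta x e_\gamma : \beta\in P,\ \gamma\in(\widehat{H}\setminus P)\cup\{\mathbb{1}_H\},\ (\beta,\gamma)\neq(\mathbb{1}_H,\mathbb{1}_H)\bigr\rangle .\]
   Context: A weight on $G$ is a function $w:G\to\mathbb{R}_{\ge0}$, not identically zero, identified with $\sum_gw(g)g\in\mathbb{C}[G]$; it is irreducible if its support generates $G$. The left-invariant random walk driven by $w$ with initial distribution $\alpha$ is the time-homogeneous Markov chain $(X_t)_{t\ge0}$ on $G$ with $X_0$ distributed as $\alpha$ and $\mathbb{P}[X_{t+1}=xg\mid X_t=x]=w(g)/\sum_{k\in G}w(k)$. The walk driven by $w$ lumps weakly to the left cosets of $H$ if for some initial distribution $\alpha$ the process $(X_tH)_{t\ge0}$ is a time-homogeneous Markov chain. $\widehat{H}$ is the set of irreducible (linear) characters of $H$, $\mathbb{1}_H$ the trivial character, and $e_\phi=|H|^{-1}\sum_{h\in H}\phi(h^{-1})h$ for $\phi\in\widehat{H}$. Angled brackets around a set denote complex linear span. For $V\subseteq\mathbb{C}[G]$, $V^\perp=\{w\in\mathbb{C}[G]:\langle v,w\rangle=0\text{ for all }v\in V\}$ with respect to $\langle\sum_g\alpha(g)g,\sum_k\beta(k)k\rangle=\frac1{|G|}\sum_{g\in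 G}\overline{\alpha(g)}\beta(g)$. *)

theory Defs
  imports "HOL-Algebra.Left_Coset" "HOL-Algebra.Generated_Groups" "HOL-Probability.Probability" "HOL-Library.Function_Algebras"
begin

section \<open>The complex group algebra\<close>

text \<open>
  An element of the group algebra of \<open>G\<close> is a function \<open>'a \<Rightarrow> complex\<close> that vanishes off
  \<open>carrier G\<close>; addition and scaling are pointwise.
\<close>

global_interpretation cfun: vector_space "\<lambda>(c::complex) (f :: 'a \<Rightarrow> complex) x. c * f x"
  by unfold_locales (auto simp: fun_eq_iff algebra_simps)

definition group_algebra :: "('a, 'b) monoid_scheme \<Rightarrow> ('a \<Rightarrow> complex) set" where
  "group_algebra G = {u. \<forall>g. g \<notin> carrier G \<longrightarrow> u g = 0}"

definition ga_mult ::
  "('a, 'b) monoid_scheme \<Rightarrow> ('a \<Rightarrow> complex) \<Rightarrow> ('a \<Rightarrow> complex) \<Rightarrow> 'a \<Rightarrow> complex" where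
  "ga_mult G u v =
    (\<lambda>g. \<Sum>(a, b) \<in> {(a, b) \<in> carrier G \<times> carrier G. a \<otimes>\<^bsub>G\<^esub> b = g}. u a * v b)"

definition ga_basis :: "'a \<Rightarrow> 'a \<Rightarrow> complex" where
  "ga_basis x = (\<lambda>g. if g = x then 1 else 0)"

definition ga_inner ::
  "('a, 'b) monoid_scheme \<Rightarrow> ('a \<Rightarrow> complex) \<Rightarrow> ('a \<Rightarrow> complex) \<Rightarrow> complex" where
  "ga_inner G u v = 1 / of_nat (card (carrier G)) * (\<Sum>g\<in>carrier G. cnj (u g) * v g)"

definition ga_perp ::
  "('a, 'b) monoid_scheme \<Rightarrow> ('a \<Rightarrow> complex) set \<Rightarrow> ('a \<Rightarrow> complex) set" where
  "ga_perp G V = {u \<in> group_algebra G. \<forall>v\<in>V. ga_inner G v u = 0}"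

section \<open>Linear characters of a subgroup\<close>

definition complex_units :: "complex monoid" where
  "complex_units = \<lparr>carrier = UNIV - {0}, monoid.mult = (*), one = 1\<rparr>"

text \<open>
  For an abelian group \<open>H\<close> the irreducible characters are the linear ones, that is the
  homomorphisms to the multiplicative group of the complex numbers. Extensionality makes
  characters that agree on \<open>H\<close> equal.
\<close>

definition linear_chars :: "('a, 'b) monoid_scheme \<Rightarrow> 'a set \<Rightarrow> ('a \<Rightarrow> complex) set" where
  "linear_chars G H = hom (G\<lparr>carrier := H\<rparr>) complex_units \<inter> extensional H"

definition trivial_char :: "'a set \<Rightarrow> 'a \<Rightarrow> complex" where
  "trivial_char H = (\<lambda>h\<in>H. 1)"

definition char_idem ::
  "('a, 'b) monoid_scheme \<Rightarrow> 'a set \<Rightarrow> ('a \<Rightarrow> complex) \<Rightarrow> 'a \<Rightarrow> complex" where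
  "char_idem G H \<phi> = (\<lambda>h. if h \<in> H then \<phi> (inv\<^bsub>G\<^esub> h) / of_nat (card H) else 0)"

definition W_space ::
  "('a, 'b) monoid_scheme \<Rightarrow> 'a set \<Rightarrow> ('a \<Rightarrow> complex) set \<Rightarrow> 'a \<Rightarrow> ('a \<Rightarrow> complex) set" where
  "W_space G H P x = cfun.span
    {ga_mult G (ga_mult G (char_idem G H \<beta>) (ga_basis x)) (char_idem G H \<gamma>) | \<beta> \<gamma>.
       \<beta> \<in> P \<and> \<gamma> \<in> (linear_chars G H - P) \<union> {trivial_char H} \<and>
       (\<beta>, \<gamma>) \<noteq> (trivial_char H, trivial_char H)}"

section \<open>Double coset representatives\<close>

definition double_coset_reps :: "('a, 'b) monoid_scheme \<Rightarrow> 'a set \<Rightarrow> 'a set \<Rightarrow> bool" where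
  "double_coset_reps G H D \<longleftrightarrow>
    D \<subseteq> carrier G \<and>
    (\<forall>C \<in> (\<lambda>g. H <#>\<^bsub>G\<^esub> (g <#\<^bsub>G\<^esub> H)) ` carrier G. \<exists>!x. x \<in> D \<and> x \<in> C)"

section \<open>Weights and random walks\<close>

text \<open>Only the values of a weight on \<open>carrier G\<close> matter.\<close>

definition weight :: "('a, 'b) monoid_scheme \<Rightarrow> ('a \<Rightarrow> real) \<Rightarrow> bool" where
  "weight G w \<longleftrightarrow> (\<forall>g\<in>carrier G. 0 \<le> w g) \<and> (\<exists>g\<in>carrier G. w g \<noteq> 0)"

definition irreducible_weight :: "('a, 'b) monoid_scheme \<Rightarrow> ('a \<Rightarrow> real) \<Rightarrow> bool" where
  "irreducible_weight G w \<longleftrightarrow>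
    weight G w \<and> generate G {g \<in> carrier G. w g \<noteq> 0} = carrier G"

definition weight_vec :: "('a, 'b) monoid_scheme \<Rightarrow> ('a \<Rightarrow> real) \<Rightarrow> 'a \<Rightarrow> complex" where
  "weight_vec G w = (\<lambda>g. if g \<in> carrier G then of_real (w g) else 0)"

text \<open>
  \<open>X\<close> is a time-homogeneous Markov chain on the finite set \<open>S\<close> with transition matrix \<open>p\<close>.
\<close>

definition markov_chain_with ::
  "'m measure \<Rightarrow> 's set \<Rightarrow> ('s \<Rightarrow> 's \<Rightarrow> real) \<Rightarrow> (nat \<Rightarrow> 'm \<Rightarrow> 's) \<Rightarrow> bool" where
  "markov_chain_with M S p X \<longleftrightarrow>
    prob_space M \<and> finite S \<and> (\<forall>t. X t \<in> measurable M (count_space S)) \<and>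
    (\<forall>x\<in>S. (\<forall>y\<in>S. 0 \<le> p x y) \<and> (\<Sum>y\<in>S. p x y) = 1) \<and>
    (\<forall>t xs y. (\<forall>i\<le>t. xs i \<in> S) \<longrightarrow> y \<in> S \<longrightarrow>
       \<P>(\<omega> in M. \<forall>i\<le>t. X i \<omega> = xs i) > 0 \<longrightarrow>
       \<P>(\<omega> in M. X (Suc t) \<omega> = y \<bar> \<forall>i\<le>t. X i \<omega> = xs i) = p (xs t) y)"

definition time_homogeneous_markov_chain ::
  "'m measure \<Rightarrow> 's set \<Rightarrow> (nat \<Rightarrow> 'm \<Rightarrow> 's) \<Rightarrow> bool" where
  "time_homogeneous_markov_chain M S X \<longleftrightarrow> (\<exists>p. markov_chain_with M S p X)"

text \<open>The probability of the step from \<open>x\<close> to \<open>y = x \<otimes> g\<close>, where \<open>g = inv x \<otimes> y\<close>.\<close>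

definition walk_step :: "('a, 'b) monoid_scheme \<Rightarrow> ('a \<Rightarrow> real) \<Rightarrow> 'a \<Rightarrow> 'a \<Rightarrow> real" where
  "walk_step G w x y = w (inv\<^bsub>G\<^esub> x \<otimes>\<^bsub>G\<^esub> y) / (\<Sum>k\<in>carrier G. w k)"

definition left_invariant_walk ::
  "('a, 'b) monoid_scheme \<Rightarrow> ('a \<Rightarrow> real) \<Rightarrow> 'a pmf \<Rightarrow> 'm measure \<Rightarrow> (nat \<Rightarrow> 'm \<Rightarrow> 'a) \<Rightarrow> bool" where
  "left_invariant_walk G w \<alpha> M X \<longleftrightarrow>
    markov_chain_with M (carrier G) (walk_step G w) X \<and>
    (\<forall>x\<in>carrier G. \<P>(\<omega> in M. X 0 \<omega> = x) = pmf \<alpha> x)"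

text \<open>
  Whether the projected process is a Markov chain depends only on the law of the walk, hence only
  on \<open>w\<close> and \<open>\<alpha>\<close>. So the choice of probability space is immaterial; here its points are
  trajectories, and every initial distribution \<open>\<alpha>\<close> is realised by the canonical process.
\<close>

definition lumps_weakly :: "('a, 'b) monoid_scheme \<Rightarrow> 'a set \<Rightarrow> ('a \<Rightarrow> real) \<Rightarrow> bool" where
  "lumps_weakly G H w \<longleftrightarrow>
    (\<exists>(\<alpha> :: 'a pmf) (M :: (nat \<Rightarrow> 'a) measure) X.
       set_pmf \<alpha> \<subseteq> carrier G \<and> left_invariant_walk G w \<alpha> M X \<and>
       time_homogeneous_markov_chain M (lcosets\<^bsub>G\<^esub> H) (\<lambda>t \<omega>. X t \<omega> <#\<^bsub>G\<^esub> H))"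

end

theory Submission
  imports Defs "HOL-Algebra.Multiplicative_Group"
begin

text \<open>
  Write \<open>w\<close> for the weight as an element of the group algebra. Once a path of left cosets has been
  observed, the law of the walk restricted to this event is a vector supported on a single left
  coset. One more observation multiplies it on the right by \<open>w\<close>, divided by the total weight, and
  restricts the result to the next coset. The image process is a Markov chain if and only if, for
  every vector that arises like this, the mass that a step sends to the next coset depends on the
  vector only through its mass and the coset that carries it.

  Right multiplication by the idempotents \<open>e\<^sub>\<gamma>\<close> splits a vector into components, one for each character
  of \<open>H\<close>. It does not move mass between left cosets, and the trivial component records the masses of
  the cosets. The inner product of \<open>e\<^sub>\<beta> x e\<^sub>\<gamma>\<close> with \<open>w\<close> is, up to a nonzero factor, the coefficient
  of \<open>x\<close> in \<open>e\<^sub>\<beta> w e\<^sub>\<gamma>\<close>, and along a double coset of \<open>H\<close> this coefficient changes only by nonzero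
  factors. Hence orthogonality to all \<open>W\<^sub>x\<close> says that \<open>e\<^sub>\<beta> w e\<^sub>\<gamma> = 0\<close> for all \<open>\<beta> \<in> P\<close> and all \<open>\<gamma>\<close>
  that are trivial or outside \<open>P\<close>, not both being trivial (lemma \<open>perp_W_space_iff\<close>).

  If these products vanish, start the walk at the uniform distribution, which has only a trivial
  component. From \<open>e\<^sub>\<beta> w e\<^sub>\<gamma> = 0\<close> with \<open>\<gamma> \<notin> P\<close> it follows that components outside \<open>P\<close> never appear,
  and from \<open>e\<^sub>\<beta> w e\<^sub>1 = 0\<close> with \<open>\<beta> \<in> P\<close> nontrivial that the nontrivial components contribute no mass
  in the next step (lemma \<open>chars_imp_lumps_weakly\<close>). This argument reconstructs a vector from its
  components, that is, it uses \<open>\<Sum>\<^sub>\<gamma> e\<^sub>\<gamma> = 1\<close>, and so rests on the fact that the characters of a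
  finite abelian group separate its points (lemma \<open>chars_separate_points\<close>).

  Conversely, suppose that the walk lumps weakly, and let \<open>P\<close> be the set of characters that occur as a
  component of the law along some path of cosets. Let \<open>u\<close> be such a law, on the coset \<open>x H\<close>. Summing the
  \<open>\<gamma>\<close>-components of \<open>u w\<close> at the points \<open>x h z\<close> with the factors \<open>\<beta>(h)\<close> isolates the
  \<open>\<beta>\<close>-component of \<open>u\<close> and multiplies it by \<open>e\<^sub>\<beta> w e\<^sub>\<gamma>\<close> (lemma \<open>double_coeff_extract\<close>). If
  \<open>\<gamma> \<notin> P\<close>, the sum is zero, because up to a factor the restrictions of \<open>u w\<close> to cosets are again laws
  along paths. If \<open>\<gamma>\<close> is trivial, the summands are masses of cosets after a step, hence multiples of
  transition probabilities from \<open>x H\<close> to \<open>x h z H\<close>. These do not depend on \<open>h\<close>, so the factors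
  \<open>\<beta>(h)\<close> cancel them when \<open>\<beta>\<close> is nontrivial. The independence of \<open>h\<close> is where irreducibility of the
  weight enters: it forces the time averages of the laws of the walk to accumulate only at the uniform
  distribution, so the lumped transition matrix is the one that the uniform distribution gives, and
  that one is invariant under left translation (lemma \<open>lumped_transition_uniform\<close>).
\<close>

section \<open>Compactness for functions on a finite set\<close>

text \<open>
  Bolzano-Weierstrass for functions on a finite set, which need not be a finite type.
\<close>

lemma bounded_functions_convergent_subsequence:
  fixes f :: "nat \<Rightarrow> 'a \<Rightarrow> real"
  assumes "finite S" and "\<And>x. x \<in> S \<Longrightarrow> bounded (range (\<lambda>n. f n x))"
  obtains l r where "strict_mono r" "\<And>x. x \<in> S \<Longrightarrow> (\<lambda>n. f (r n) x) \<longlonglongrightarrow> l x"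
proof -
  have "\<forall>d\<subseteq>S. \<exists>l. \<exists>r. strict_mono r \<and>
      (\<forall>e>0. eventually (\<lambda>n. \<forall>x\<in>d. dist (f (r n) x) (l x) < e) sequentially)"
    by (rule compact_lemma_general[where proj = "\<lambda>f x. f x" and unproj = "\<lambda>f. f"])
       (use assms in \<open>auto simp: image_image\<close>)
  then obtain l r where "strict_mono r"
    and lim: "\<And>e. e > 0 \<Longrightarrow> eventually (\<lambda>n. \<forall>x\<in>S. dist (f (r n) x) (l x) < e) sequentially"
    by blast
  moreover have "(\<lambda>n. f (r n) x) \<longlonglongrightarrow> l x" if x: "x \<in> S" for x
    unfolding tendsto_iff using lim x by (blast intro: eventually_mono)
  ultimately show ?thesis using that by blast
qed

section \<open>Images of finite Markov chains\<close>

lemma markov_chainD: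
  assumes "markov_chain_with M S p X"
  shows "prob_space M" "finite S" "X t \<in> measurable M (count_space S)"
    "x \<in> S \<Longrightarrow> y \<in> S \<Longrightarrow> 0 \<le> p x y" "x \<in> S \<Longrightarrow> (\<Sum>y\<in>S. p x y) = 1"
  using assms by (auto simp: markov_chain_with_def)

lemma markov_chain_in_states:
  assumes "markov_chain_with M S p X" "\<omega> \<in> space M" shows "X t \<omega> \<in> S"
  using measurable_space[OF markov_chainD(3)[OF assms(1)] assms(2)] by simp

text \<open>
  The product form of the Markov property has no side condition: if the path has probability zero,
  then so has each of its extensions.
\<close>

lemma markov_path_step:
  assumes mc: "markov_chain_with M S p X" and xs: "\<And>i. i \<le> t \<Longrightarrow> xs i \<in> S" and y: "y \<in> S"
  shows "\<P>(\<omega> in M. (\<forall>i\<le>t. X i \<omega> = xs i) \<and> X (Suc t) \<omega> = y)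
    = \<P>(\<omega> in M. \<forall>i\<le>t. X i \<omega> = xs i) * p (xs t) y"
proof -
  interpret prob_space M by (rule markov_chainD[OF mc])
  note [measurable] = markov_chainD(3)[OF mc]
  let ?A = "\<P>(\<omega> in M. \<forall>i\<le>t. X i \<omega> = xs i)"
  show ?thesis
  proof (cases "?A > 0")
    case True
    hence "\<P>(\<omega> in M. X (Suc t) \<omega> = y \<bar> \<forall>i\<le>t. X i \<omega> = xs i) = p (xs t) y"
      using mc xs y unfolding markov_chain_with_def by blast
    thus ?thesis using True by (simp add: cond_prob_def field_simps conj_commute)
  next
    case False
    hence A: "?A = 0" by (simp add: antisym zero_less_measure_iff)
    have "\<P>(\<omega> in M. (\<forall>i\<le>t. X i \<omega> = xs i) \<and> X (Suc t) \<omega> = y) \<le> ?A"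
      by (rule finite_measure_mono) (auto, measurable)
    with A have "\<P>(\<omega> in M. (\<forall>i\<le>t. X i \<omega> = xs i) \<and> X (Suc t) \<omega> = y) \<le> 0" by simp
    thus ?thesis using A by (simp add: measure_le_0_iff)
  qed
qed

text \<open>
  An event that depends only on the states up to time \<open>t\<close> is a finite disjoint union of cylinders.
  This extends the Markov property from single paths to such events.
\<close>

lemma prob_sum_over_paths:
  assumes mc: "markov_chain_with M S p X"
    and E: "\<And>xs ys. (\<And>i. i \<le> t \<Longrightarrow> xs i = ys i) \<Longrightarrow> E xs = E ys"
    and B: "{\<omega> \<in> space M. B \<omega>} \<in> sets M"
  shows "\<P>(\<omega> in M. E (\<lambda>i. X i \<omega>) \<and> B \<omega>)
    = (\<Sum>xs | xs \<in> {..t} \<rightarrow>\<^sub>E S \<and> E xs. \<P>(\<omega> in M. (\<forall>i\<le>t. X i \<omega> = xs i) \<and> B \<omega>))"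
proof -
  interpret prob_space M by (rule markov_chainD[OF mc])
  note [measurable] = markov_chainD(3)[OF mc]
  let ?F = "{xs \<in> {..t} \<rightarrow>\<^sub>E S. E xs}"
  let ?C = "\<lambda>xs. {\<omega> \<in> space M. (\<forall>i\<le>t. X i \<omega> = xs i) \<and> B \<omega>}"
  have fin: "finite ?F" using markov_chainD(2)[OF mc] by (simp add: finite_PiE)
  have [measurable]: "Measurable.pred M B" using B by (simp add: pred_def)
  have sets: "?C ` ?F \<subseteq> sets M" by auto
  have disj: "disjoint_family_on ?C ?F"
  proof (unfold disjoint_family_on_def, intro ballI impI)
    fix xs ys assume "xs \<in> ?F" "ys \<in> ?F" "xs \<noteq> ys"
    then obtain i where "i \<le> t" "xs i \<noteq> ys i"
      by (auto dest: PiE_ext[of xs _ _ ys])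
    thus "?C xs \<inter> ?C ys = {}" by auto
  qed
  have "{\<omega> \<in> space M. E (\<lambda>i. X i \<omega>) \<and> B \<omega>} = (\<Union>xs\<in>?F. ?C xs)"
  proof (intro equalityI subsetI)
    fix \<omega> assume \<omega>: "\<omega> \<in> {\<omega> \<in> space M. E (\<lambda>i. X i \<omega>) \<and> B \<omega>}"
    let ?xs = "restrict (\<lambda>i. X i \<omega>) {..t}"
    have "E ?xs" using \<omega> E[of "?xs" "\<lambda>i. X i \<omega>"] by simp
    moreover have "?xs \<in> {..t} \<rightarrow>\<^sub>E S" using \<omega> markov_chain_in_states[OF mc] by auto
    ultimately have "?xs \<in> ?F" "\<omega> \<in> ?C ?xs" using \<omega> by auto
    thus "\<omega> \<in> (\<Union>xs\<in>?F. ?C xs)" by blast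
  next
    fix \<omega> assume "\<omega> \<in> (\<Union>xs\<in>?F. ?C xs)"
    then obtain xs where "E xs" "\<omega> \<in> ?C xs" by blast
    thus "\<omega> \<in> {\<omega> \<in> space M. E (\<lambda>i. X i \<omega>) \<and> B \<omega>}" using E[of xs "\<lambda>i. X i \<omega>"] by auto
  qed
  thus ?thesis using finite_measure_finite_Union[OF fin sets disj] by simp
qed

lemma markov_event_step:
  assumes mc: "markov_chain_with M S p X"
    and E: "\<And>xs ys. (\<And>i. i \<le> t \<Longrightarrow> xs i = ys i) \<Longrightarrow> E xs = E ys"
    and y: "y \<in> S"
  shows "\<P>(\<omega> in M. E (\<lambda>i. X i \<omega>) \<and> X t \<omega> = x \<and> X (Suc t) \<omega> = y)
    = \<P>(\<omega> in M. E (\<lambda>i. X i \<omega>) \<and> X t \<omega> = x) * p x y"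
proof -
  note [measurable] = markov_chainD(3)[OF mc]
  let ?F = "{xs. xs \<in> {..t} \<rightarrow>\<^sub>E S \<and> (E xs \<and> xs t = x)}"
  have Ex: "(E xs \<and> xs t = x) = (E ys \<and> ys t = x)" if "\<And>i. i \<le> t \<Longrightarrow> xs i = ys i" for xs ys
    using E[OF that] that[of t] by auto
  have "\<P>(\<omega> in M. E (\<lambda>i. X i \<omega>) \<and> X t \<omega> = x \<and> X (Suc t) \<omega> = y)
      = (\<Sum>xs\<in>?F. \<P>(\<omega> in M. (\<forall>i\<le>t. X i \<omega> = xs i) \<and> X (Suc t) \<omega> = y))"
    using prob_sum_over_paths[OF mc, of t "\<lambda>xs. E xs \<and> xs t = x" "\<lambda>\<omega>. X (Suc t) \<omega> = y", OF Ex]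
    by simp
  also have "\<dots> = (\<Sum>xs\<in>?F. \<P>(\<omega> in M. \<forall>i\<le>t. X i \<omega> = xs i) * p x y)"
    by (intro sum.cong refl, subst markov_path_step[OF mc _ y]) auto
  also have "\<dots> = \<P>(\<omega> in M. E (\<lambda>i. X i \<omega>) \<and> X t \<omega> = x) * p x y"
    using prob_sum_over_paths[OF mc, of t "\<lambda>xs. E xs \<and> xs t = x" "\<lambda>\<omega>. True", OF Ex]
    by (simp add: sum_distrib_right)
  finally show ?thesis .
qed

lemma prob_split_state:
  assumes mc: "markov_chain_with M S p X" and E: "{\<omega> \<in> space M. E \<omega>} \<in> sets M" and A: "A \<subseteq> S"
  shows "\<P>(\<omega> in M. E \<omega> \<and> X t \<omega> \<in> A) = (\<Sum>x\<in>A. \<P>(\<omega> in M. E \<omega> \<and> X t \<omega> = x))"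
proof -
  interpret prob_space M by (rule markov_chainD[OF mc])
  note [measurable] = markov_chainD(3)[OF mc]
  have [measurable]: "Measurable.pred M E" using E by (simp add: pred_def)
  have "finite A" using A markov_chainD(2)[OF mc] finite_subset by blast
  hence "prob (\<Union>x\<in>A. {\<omega> \<in> space M. E \<omega> \<and> X t \<omega> = x})
      = (\<Sum>x\<in>A. \<P>(\<omega> in M. E \<omega> \<and> X t \<omega> = x))"
    by (rule finite_measure_finite_Union) (auto simp: disjoint_family_on_def)
  moreover have "{\<omega> \<in> space M. E \<omega> \<and> X t \<omega> \<in> A} = (\<Union>x\<in>A. {\<omega> \<in> space M. E \<omega> \<and> X t \<omega> = x})"
    by auto
  ultimately show ?thesis by simp
qed

corollary prob_sum_over_states:
  assumes mc: "markov_chain_with M S p X" and E: "{\<omega> \<in> space M. E \<omega>} \<in> sets M"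
  shows "\<P>(\<omega> in M. E \<omega>) = (\<Sum>x\<in>S. \<P>(\<omega> in M. E \<omega> \<and> X t \<omega> = x))"
proof -
  have "{\<omega> \<in> space M. E \<omega>} = {\<omega> \<in> space M. E \<omega> \<and> X t \<omega> \<in> S}"
    using markov_chain_in_states[OF mc] by auto
  thus ?thesis using prob_split_state[OF mc E subset_refl] by simp
qed

text \<open>
  The law of the state at time \<open>t\<close>, restricted to the event that the image process follows \<open>bs\<close>. It
  is left unnormalised so that it stays a linear function of the initial law and is defined for
  paths of probability zero as well.
\<close>

definition image_path_law ::
  "'m measure \<Rightarrow> (nat \<Rightarrow> 'm \<Rightarrow> 's) \<Rightarrow> ('s \<Rightarrow> 'r) \<Rightarrow> nat \<Rightarrow> (nat \<Rightarrow> 'r) \<Rightarrow> 's \<Rightarrow> real" where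
  "image_path_law M X f t bs x = \<P>(\<omega> in M. (\<forall>i\<le>t. f (X i \<omega>) = bs i) \<and> X t \<omega> = x)"

lemma image_path_law_cong:
  "(\<And>i. i \<le> t \<Longrightarrow> bs i = bs' i) \<Longrightarrow> image_path_law M X f t bs x = image_path_law M X f t bs' x"
  by (simp add: image_path_law_def)

lemma image_path_law_0:
  "image_path_law M X f 0 bs x = (if f x = bs 0 then \<P>(\<omega> in M. X 0 \<omega> = x) else 0)"
proof -
  have "{\<omega> \<in> space M. f (X 0 \<omega>) = bs 0 \<and> X 0 \<omega> = x}
      = (if f x = bs 0 then {\<omega> \<in> space M. X 0 \<omega> = x} else {})" by auto
  thus ?thesis by (simp add: image_path_law_def)
qed

lemma image_path_law_outside:
  "f x \<noteq> bs t \<Longrightarrow> image_path_law M X f t bs x = 0"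
proof -
  assume "f x \<noteq> bs t"
  hence "{\<omega> \<in> space M. (\<forall>i\<le>t. f (X i \<omega>) = bs i) \<and> X t \<omega> = x} = {}" by auto
  thus ?thesis by (simp add: image_path_law_def del: Collect_empty_eq)
qed

lemma image_path_measurable:
  assumes mc: "markov_chain_with M S p X"
  shows "{\<omega> \<in> space M. \<forall>i\<le>t. f (X i \<omega>) = bs i} \<in> sets M"
proof -
  have [measurable]: "(\<lambda>\<omega>. f (X i \<omega>)) \<in> measurable M (count_space UNIV)" for i
    by (rule measurable_compose[OF markov_chainD(3)[OF mc]]) simp
  show ?thesis by measurable
qed

lemma image_path_law_Suc:
  assumes mc: "markov_chain_with M S p X" and y: "y \<in> S"
  shows "image_path_law M X f (Suc t) bs y =
    (if f y = bs (Suc t) then \<Sum>x\<in>S. image_path_law M X f t bs x * p x y else 0)"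
proof (cases "f y = bs (Suc t)")
  case True
  note [measurable] = markov_chainD(3)[OF mc]
  let ?E = "\<lambda>\<omega>. \<forall>i\<le>t. f (X i \<omega>) = bs i"
  have "{\<omega> \<in> space M. (\<forall>i\<le>Suc t. f (X i \<omega>) = bs i) \<and> X (Suc t) \<omega> = y}
      = {\<omega> \<in> space M. ?E \<omega> \<and> X (Suc t) \<omega> = y}"
    using True by (auto simp: le_Suc_eq)
  hence "image_path_law M X f (Suc t) bs y = \<P>(\<omega> in M. ?E \<omega> \<and> X (Suc t) \<omega> = y)"
    by (simp add: image_path_law_def)
  also have "\<dots> = (\<Sum>x\<in>S. \<P>(\<omega> in M. (?E \<omega> \<and> X (Suc t) \<omega> = y) \<and> X t \<omega> = x))"
    by (rule prob_sum_over_states[OF mc sets.sets_Collect_conj[OF _ image_path_measurable[OF mc]]]) measurable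
  also have "\<dots> = (\<Sum>x\<in>S. \<P>(\<omega> in M. ?E \<omega> \<and> X t \<omega> = x \<and> X (Suc t) \<omega> = y))"
    by (intro sum.cong refl arg_cong[where f = "measure M"] Collect_cong) blast
  also have "\<dots> = (\<Sum>x\<in>S. image_path_law M X f t bs x * p x y)"
    unfolding image_path_law_def
    by (intro sum.cong refl markov_event_step[OF mc _ y, of t "\<lambda>xs. \<forall>i\<le>t. f (xs i) = bs i"]) auto
  finally show ?thesis using True by simp
qed (simp add: image_path_law_outside)

lemma prob_image_path:
  assumes mc: "markov_chain_with M S p X"
  shows "\<P>(\<omega> in M. \<forall>i\<le>t. f (X i \<omega>) = bs i) = (\<Sum>x\<in>S. image_path_law M X f t bs x)"
  unfolding image_path_law_def by (rule prob_sum_over_states[OF mc image_path_measurable[OF mc]])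

section \<open>Cosets of an abelian subgroup\<close>

locale finite_group_abelian_subgroup = group G for G :: "('a, 'b) monoid_scheme" (structure) +
  fixes H :: "'a set"
  assumes finite_carrier: "finite (carrier G)"
    and subgroup_H: "subgroup H G"
    and abelian_H: "comm_group (G\<lparr>carrier := H\<rparr>)"
begin

abbreviation chars :: "('a \<Rightarrow> complex) set" where "chars \<equiv> linear_chars G H"
abbreviation coset :: "'a \<Rightarrow> 'a set" where "coset x \<equiv> x <# H"
abbreviation triv :: "'a \<Rightarrow> complex" where "triv \<equiv> trivial_char H"

lemma H_subset: "H \<subseteq> carrier G"
  using subgroup_H subgroup.subset by blast

lemma H_in_carrier [simp]: "h \<in> H \<Longrightarrow> h \<in> carrier G"
  using H_subset by blast

lemma H_closed [simp]:
  "h \<in> H \<Longrightarrow> k \<in> H \<Longrightarrow> h \<otimes> k \<in> H" "h \<in> H \<Longrightarrow> inv h \<in> H" "\<one> \<in> H"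
  using subgroup_H by (auto intro: subgroup.m_closed subgroup.m_inv_closed subgroup.one_closed)

lemma H_nat_pow [simp]: "h \<in> H \<Longrightarrow> h [^] (n::nat) \<in> H"
  by (induction n) auto

lemma finite_H [simp]: "finite H"
  using H_subset finite_carrier finite_subset by blast

lemma H_nonempty [simp]: "H \<noteq> {}"
  using subgroup.one_closed[OF subgroup_H] by blast

lemma card_H_pos: "0 < card H"
  by (simp add: card_gt_0_iff)

lemma H_commute: "h \<in> H \<Longrightarrow> k \<in> H \<Longrightarrow> h \<otimes> k = k \<otimes> h"
  using comm_monoid.m_comm[OF comm_group.axioms(1)[OF abelian_H], of h k] by simp

lemma H_nat_pow_card: "h \<in> H \<Longrightarrow> h [^] card H = \<one>"
  using group.pow_order_eq_1[OF subgroup_imp_group[OF subgroup_H], of h]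
  by (simp add: Coset.order_def nat_pow_def)

lemma mult_inv_cancel:
  "x \<in> carrier G \<Longrightarrow> a \<in> carrier G \<Longrightarrow> x \<otimes> (inv x \<otimes> a) = a"
  "x \<in> carrier G \<Longrightarrow> a \<in> carrier G \<Longrightarrow> inv x \<otimes> (x \<otimes> a) = a"
  by (simp_all add: m_assoc[symmetric])

lemma sum_H_translate:
  assumes "h \<in> H" shows "(\<Sum>k\<in>H. f (h \<otimes> k)) = (\<Sum>k\<in>H. f k)"
  by (rule sum.reindex_bij_witness[where i = "\<lambda>k. inv h \<otimes> k" and j = "\<lambda>k. h \<otimes> k"])
    (use assms in \<open>auto simp: m_assoc[symmetric]\<close>)

lemma sum_carrier_right_translate:
  assumes "g \<in> carrier G" shows "(\<Sum>x\<in>carrier G. f (x \<otimes> g)) = (\<Sum>x\<in>carrier G. f x)"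
  by (rule sum.reindex_bij_witness[where i = "\<lambda>k. k \<otimes> inv g" and j = "\<lambda>k. k \<otimes> g"])
    (use assms in \<open>auto simp: m_assoc\<close>)

lemma sum_coset:
  assumes "x \<in> carrier G" shows "(\<Sum>y\<in>x <# H. f y) = (\<Sum>k\<in>H. f (x \<otimes> k))"
proof -
  have "x <# H = (\<lambda>k. x \<otimes> k) ` H" by (auto simp: l_coset_def)
  moreover have "inj_on (\<lambda>k. x \<otimes> k) H" using inj_on_g'[OF H_subset assms] .
  ultimately show ?thesis by (simp add: sum.reindex)
qed

lemma coset_mult_H:
  assumes "x \<in> carrier G" "h \<in> H" shows "coset (x \<otimes> h) = coset x"
proof -
  have "x \<otimes> h \<in> x <# H" using assms(2) by (auto simp: l_coset_def)
  from l_repr_independence[OF this assms(1) subgroup_H] show ?thesis by simp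
qed

lemma in_coset_iff:
  assumes "x \<in> carrier G" "y \<in> carrier G"
  shows "y \<in> coset x \<longleftrightarrow> coset y = coset x"
  using assms l_repr_independence[OF _ assms(1) subgroup_H] lcos_self[OF assms(2) subgroup_H] by blast

lemma in_lcoset_iff:
  assumes "b \<in> lcosets H" "x \<in> carrier G"
  shows "x \<in> b \<longleftrightarrow> coset x = b"
  using assms in_coset_iff by (auto simp: LCOSETS_def)

lemma coset_in_lcosets [simp]: "x \<in> carrier G \<Longrightarrow> x <# H \<in> lcosets H"
  by (auto simp: LCOSETS_def)

lemma finite_lcosets [simp]: "finite (lcosets H)"
  using finite_carrier by (simp add: LCOSETS_def)

section \<open>Characters\<close>

lemma char_mult: "\<phi> \<in> chars \<Longrightarrow> h \<in> H \<Longrightarrow> k \<in> H \<Longrightarrow> \<phi> (h \<otimes> k) = \<phi> h * \<phi> k"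
  by (auto simp: linear_chars_def hom_def complex_units_def)

lemma char_nonzero: "\<phi> \<in> chars \<Longrightarrow> h \<in> H \<Longrightarrow> \<phi> h \<noteq> 0"
  by (auto simp: linear_chars_def hom_def complex_units_def)

lemma char_one: "\<phi> \<in> chars \<Longrightarrow> \<phi> \<one> = 1"
  using char_mult[of \<phi> \<one> \<one>] char_nonzero[of \<phi> \<one>] by simp

lemma char_inv: "\<phi> \<in> chars \<Longrightarrow> h \<in> H \<Longrightarrow> \<phi> (inv h) * \<phi> h = 1"
  using char_mult[of \<phi> "inv h" h] by (simp add: char_one)

lemma char_pow: "\<phi> \<in> chars \<Longrightarrow> h \<in> H \<Longrightarrow> \<phi> (h [^] (n::nat)) = \<phi> h ^ n"
  by (induction n) (simp_all add: char_one char_mult)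

lemma char_root_of_unity: "\<phi> \<in> chars \<Longrightarrow> h \<in> H \<Longrightarrow> \<phi> h ^ card H = 1"
  using char_pow[of \<phi> h "card H"] by (simp add: H_nat_pow_card char_one)

text \<open>
  Values of characters are roots of unity, hence on the unit circle.
\<close>

lemma cnj_char: "\<phi> \<in> chars \<Longrightarrow> h \<in> H \<Longrightarrow> cnj (\<phi> h) = \<phi> (inv h)"
proof -
  assume \<phi>: "\<phi> \<in> chars" and h: "h \<in> H"
  have "norm (\<phi> h) ^ card H = 1"
    using char_root_of_unity[OF \<phi> h] by (metis norm_one norm_power)
  hence "norm (\<phi> h) = 1" using card_H_pos power_eq_imp_eq_base[of "norm (\<phi> h)" "card H" 1] by simp
  hence "cnj (\<phi> h) * \<phi> h = 1" by (metis complex_norm_square mult.commute of_real_1 power_one)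
  thus ?thesis using char_inv[OF \<phi> h] char_nonzero[OF \<phi> h] by (metis mult_right_cancel)
qed

lemma triv_char: "triv \<in> chars"
  by (auto simp: linear_chars_def trivial_char_def hom_def complex_units_def)

lemma triv_apply [simp]: "h \<in> H \<Longrightarrow> triv h = 1"
  by (simp add: trivial_char_def)

lemma char_eqI:
  assumes "\<phi> \<in> chars" "\<psi> \<in> chars" "\<And>h. h \<in> H \<Longrightarrow> \<phi> h = \<psi> h"
  shows "\<phi> = \<psi>"
  using assms by (auto simp: linear_chars_def intro: extensionalityI)

lemma finite_chars: "finite chars"
proof (rule finite_subset)
  show "chars \<subseteq> H \<rightarrow>\<^sub>E {z::complex. z ^ card H = 1}"
    using char_root_of_unity by (auto simp: linear_chars_def PiE_def)
  show "finite (H \<rightarrow>\<^sub>E {z::complex. z ^ card H = 1})"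
    using finite_roots_unity[of "card H"] card_H_pos by (intro finite_PiE) auto
qed

text \<open>
  Translation by an element at which \<open>\<phi>\<close> is not \<open>1\<close> multiplies the sum by that value.
\<close>

lemma sum_char_over_H:
  assumes "\<phi> \<in> chars" shows "(\<Sum>h\<in>H. \<phi> h) = (if \<phi> = triv then of_nat (card H) else 0)"
proof (cases "\<phi> = triv")
  case False
  then obtain k where k: "k \<in> H" "\<phi> k \<noteq> 1"
    using char_eqI[OF assms triv_char] by auto
  have "\<phi> k * (\<Sum>h\<in>H. \<phi> h) = (\<Sum>h\<in>H. \<phi> h)"
    using sum_H_translate[OF k(1), of \<phi>] by (simp add: sum_distrib_left char_mult[OF assms k(1)])
  thus ?thesis using k(2) False by simp
qed simp

lemma restrict_char:
  assumes "\<And>h k. h \<in> H \<Longrightarrow> k \<in> H \<Longrightarrow> f (h \<otimes> k) = f h * f k"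
    and "\<And>h. h \<in> H \<Longrightarrow> f h \<noteq> 0"
  shows "restrict f H \<in> chars"
  using assms by (simp add: linear_chars_def hom_def complex_units_def Pi_iff)

lemma char_prod: "\<phi> \<in> chars \<Longrightarrow> \<psi> \<in> chars \<Longrightarrow> (\<lambda>h\<in>H. \<phi> h * \<psi> h) \<in> chars"
  by (rule restrict_char) (simp_all add: char_mult char_nonzero)

lemma char_inverse: "\<phi> \<in> chars \<Longrightarrow> (\<lambda>h\<in>H. inverse (\<phi> h)) \<in> chars"
  by (rule restrict_char) (simp_all add: char_mult char_nonzero)

text \<open>
  Projection of \<open>f\<close> to the \<open>\<zeta>\<close>-eigenspace of translation by \<open>b\<close>, up to the factor \<open>card H\<close>.
\<close>

definition eigen_part :: "'a \<Rightarrow> complex \<Rightarrow> ('a \<Rightarrow> complex) \<Rightarrow> 'a \<Rightarrow> complex" where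
  "eigen_part b \<zeta> f = (\<lambda>x. \<Sum>j<card H. inverse \<zeta> ^ j * f (b [^] j \<otimes> x))"

lemma eigen_part_translate:
  assumes b: "b \<in> H" and x: "x \<in> H" and \<zeta>: "\<zeta> ^ card H = 1"
  shows "eigen_part b \<zeta> f (b \<otimes> x) = \<zeta> * eigen_part b \<zeta> f x"
proof -
  define a where "a j = inverse \<zeta> ^ j * f (b [^] j \<otimes> x)" for j
  have nz: "\<zeta> \<noteq> 0" using \<zeta> card_H_pos by (metis power_0_left zero_neq_one not_less0)
  have term_eq: "inverse \<zeta> ^ j * f (b [^] j \<otimes> (b \<otimes> x)) = \<zeta> * a (Suc j)" for j
    using b x nz by (simp add: a_def m_assoc)
  have "a (card H) = a 0"
    using b x by (simp add: a_def H_nat_pow_card power_inverse \<zeta>)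
  hence "(\<Sum>j<card H. a (Suc j)) = (\<Sum>j<card H. a j)"
    using sum.lessThan_Suc_shift[of a "card H"] sum.lessThan_Suc[of a "card H"] by simp
  thus ?thesis
    by (simp add: eigen_part_def term_eq flip: sum_distrib_left) (simp add: a_def)
qed

text \<open>
  The parts of \<open>f\<close> for all roots of unity of order dividing \<open>card H\<close> add up to a multiple of \<open>f\<close>, so
  at each point where \<open>f\<close> does not vanish one of them does not vanish.
\<close>

lemma eigen_part_nonzero:
  assumes b: "b \<in> H" and x: "x \<in> H" and f: "f x \<noteq> 0"
  obtains \<zeta> where "\<zeta> ^ card H = 1" "eigen_part b \<zeta> f x \<noteq> 0"
proof -
  define n where "n = card H"
  have n: "n > 0" using card_H_pos by (simp add: n_def)
  define \<omega> where "\<omega> = (\<lambda>k. cis (2 * pi * real k / real n))"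
  have \<omega>_root: "\<omega> k ^ n = 1" for k
  proof -
    have "\<omega> k ^ n = cis (real n * (2 * pi * real k / real n))"
      unfolding \<omega>_def by (simp only: Complex.DeMoivre)
    also have "real n * (2 * pi * real k / real n) = 2 * pi * real k" using n by simp
    finally show ?thesis using cis_multiple_2pi[of "real k"] by simp
  qed
  have geometric: "(\<Sum>k<n. inverse (\<omega> k) ^ j) = (if j = 0 then of_nat n else 0)" if j: "j < n" for j
  proof (cases "j = 0")
    case False
    have pow: "inverse (\<omega> k) ^ j = inverse (\<omega> j) ^ k" for k
      by (simp add: \<omega>_def Complex.DeMoivre power_inverse mult.commute mult.left_commute)
    have ne: "inverse (\<omega> j) \<noteq> 1"
    proof
      assume "inverse (\<omega> j) = 1"
      hence "\<omega> j = 1" by (metis inverse_eq_1_iff)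
      hence "\<omega> j = \<omega> 0" by (simp add: \<omega>_def)
      moreover have "inj_on \<omega> {..<n}"
        using Complex.bij_betw_roots_unity[OF n] unfolding \<omega>_def bij_betw_def by simp
      ultimately show False using False j n by (auto dest: inj_onD)
    qed
    have "(\<Sum>k<n. inverse (\<omega> j) ^ k) = (inverse (\<omega> j) ^ n - 1) / (inverse (\<omega> j) - 1)"
      using geometric_sum[OF ne] by simp
    also have "inverse (\<omega> j) ^ n = 1" by (simp add: power_inverse \<omega>_root)
    finally show ?thesis using False by (simp add: pow)
  qed simp
  have "(\<Sum>k<n. eigen_part b (\<omega> k) f x)
      = (\<Sum>j<n. (\<Sum>k<n. inverse (\<omega> k) ^ j) * f (b [^] j \<otimes> x))"
    unfolding eigen_part_def n_def[symmetric] by (subst sum.swap) (simp add: sum_distrib_right)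
  also have "\<dots> = (\<Sum>j<n. if j = 0 then of_nat n * f x else 0)"
    by (intro sum.cong) (use x in \<open>auto simp: geometric\<close>)
  also have "\<dots> = of_nat n * f x" using n by simp
  finally have "(\<Sum>k<n. eigen_part b (\<omega> k) f x) \<noteq> 0" using f n by simp
  then obtain k where "eigen_part b (\<omega> k) f x \<noteq> 0" by (meson sum.neutral)
  thus ?thesis using that \<omega>_root[of k] by (simp add: n_def)
qed

text \<open>
  Translations by elements of \<open>H\<close> commute, so passing to a further eigenspace keeps the eigenvalues
  obtained before. The eigenvalue \<open>\<mu>\<close> at \<open>h\<close> can therefore be prescribed in advance.
\<close>

lemma joint_eigenfunction:
  fixes f :: "'a \<Rightarrow> complex"
  assumes A: "finite A" "A \<subseteq> H"
    and f: "x \<in> H" "f x \<noteq> 0" and h: "h \<in> H" "\<And>y. y \<in> H \<Longrightarrow> f (h \<otimes> y) = \<mu> * f y"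
  shows "\<exists>f' x' \<nu>. x' \<in> H \<and> f' x' \<noteq> 0 \<and> (\<forall>y\<in>H. f' (h \<otimes> y) = \<mu> * f' y) \<and>
      (\<forall>a\<in>A. \<forall>y\<in>H. f' (a \<otimes> y) = \<nu> a * f' y)"
  using A
proof (induction A rule: finite_induct)
  case empty
  show ?case using f h by (intro exI[of _ f] exI[of _ x]) auto
next
  case (insert b A)
  then obtain f' x' \<nu> where f': "x' \<in> H" "f' x' \<noteq> 0"
    and h': "\<And>y. y \<in> H \<Longrightarrow> f' (h \<otimes> y) = \<mu> * f' y"
    and A': "\<And>a y. a \<in> A \<Longrightarrow> y \<in> H \<Longrightarrow> f' (a \<otimes> y) = \<nu> a * f' y" by blast
  have b: "b \<in> H" and AH: "A \<subseteq> H" using insert.prems by auto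
  obtain \<zeta> where \<zeta>: "\<zeta> ^ card H = 1" "eigen_part b \<zeta> f' x' \<noteq> 0"
    using eigen_part_nonzero[of b x' f', OF b f'] by blast
  have keep: "eigen_part b \<zeta> f' (k \<otimes> y) = c * eigen_part b \<zeta> f' y"
    if k: "k \<in> H" and y: "y \<in> H" and eig: "\<And>y. y \<in> H \<Longrightarrow> f' (k \<otimes> y) = c * f' y" for k y c
  proof -
    have "f' (b [^] j \<otimes> (k \<otimes> y)) = c * f' (b [^] j \<otimes> y)" for j :: nat
    proof -
      have "b [^] j \<otimes> (k \<otimes> y) = k \<otimes> (b [^] j \<otimes> y)"
        using H_commute[of "b [^] j" k] b k y by (simp add: m_assoc[symmetric])
      thus ?thesis using eig[of "b [^] j \<otimes> y"] b y by simp
    qed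
    thus ?thesis by (simp add: eigen_part_def sum_distrib_left mult.left_commute)
  qed
  show ?case
    using f'(1) \<zeta> keep h h' A' AH b insert.hyps(2) eigen_part_translate[OF b _ \<zeta>(1)]
    by (intro exI[of _ "eigen_part b \<zeta> f'"] exI[of _ x'] exI[of _ "\<nu>(b := \<zeta>)"])
       (auto simp: subset_iff)
qed

text \<open>
  A function on \<open>H\<close> that is an eigenfunction of all translations is a multiple of a character, and
  the value of this character at \<open>h\<close> is the eigenvalue at \<open>h\<close>. So it is enough to find one eigenfunction
  for \<open>h\<close> with an eigenvalue other than \<open>1\<close>.
\<close>

lemma chars_separate_points:
  assumes h: "h \<in> H" "h \<noteq> \<one>"
  obtains \<phi> where "\<phi> \<in> chars" "\<phi> h \<noteq> 1"
proof -
  \<comment> \<open>The difference of a function and its translate by \<open>h\<close> has no part with eigenvalue \<open>1\<close>.\<close>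
  define d where "d = (\<lambda>x. (if x = \<one> then 1 else 0) - (if h \<otimes> x = \<one> then 1 else 0 :: complex))"
  have "d \<one> \<noteq> 0" using h by (simp add: d_def)
  then obtain \<zeta> where \<zeta>: "\<zeta> ^ card H = 1" "eigen_part h \<zeta> d \<one> \<noteq> 0"
    using eigen_part_nonzero[of h \<one> d] h by auto
  have "\<zeta> \<noteq> 1"
  proof
    assume 1: "\<zeta> = 1"
    define e where "e = (\<lambda>j::nat. if h [^] j = \<one> then 1 else 0 :: complex)"
    have "eigen_part h \<zeta> d \<one> = (\<Sum>j<card H. e j - e (Suc j))"
      using h H_commute[OF h(1), of "h [^] (_::nat)"] by (simp add: eigen_part_def d_def e_def 1)
    also have "\<dots> = e 0 - e (card H)" by (rule sum_lessThan_telescope')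
    also have "\<dots> = 0" using h by (simp add: e_def H_nat_pow_card)
    finally show False using \<zeta> by simp
  qed
  obtain f x \<nu> where fx: "x \<in> H" "f x \<noteq> 0"
    and fh: "\<And>y. y \<in> H \<Longrightarrow> f (h \<otimes> y) = \<zeta> * f y"
    and f: "\<And>a y. a \<in> H \<Longrightarrow> y \<in> H \<Longrightarrow> f (a \<otimes> y) = \<nu> a * f y"
    using joint_eigenfunction[OF finite_H subset_refl _ \<zeta>(2) h(1) eigen_part_translate[OF h(1) _ \<zeta>(1)]]
      H_closed(3) by blast
  have f1: "f a = \<nu> a * f \<one>" if "a \<in> H" for a using f[of a \<one>] that by simp
  have f_ne: "f \<one> \<noteq> 0" using f1[OF fx(1)] fx(2) by auto
  have mult: "\<nu> (a \<otimes> b) = \<nu> a * \<nu> b" if "a \<in> H" "b \<in> H" for a b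
    using f[OF that] f1[of "a \<otimes> b"] f1[OF that(2)] that f_ne by simp
  have nz: "\<nu> a \<noteq> 0" if "a \<in> H" for a
    using mult[of a "inv a"] f1[of \<one>] f_ne that by auto
  have "restrict \<nu> H \<in> chars"
    using mult nz by (rule restrict_char)
  moreover have "\<nu> h = \<zeta>" using fh[of \<one>] f1[of h] h f_ne by simp
  ultimately show ?thesis using that[of "restrict \<nu> H"] h \<open>\<zeta> \<noteq> 1\<close> by simp
qed

text \<open>
  Column orthogonality. Multiplication by a character that separates \<open>h\<close> from \<open>\<one>\<close> permutes the
  characters, and the number of characters is \<open>card H\<close> because both orders of summation over \<open>H\<close> and
  the characters must give the same result.
\<close>

lemma sum_over_chars:
  assumes "h \<in> H"
  shows "(\<Sum>\<phi>\<in>chars. \<phi> h) = (if h = \<one> then of_nat (card H) else 0)"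
proof -
  have zero: "(\<Sum>\<phi>\<in>chars. \<phi> k) = 0" if k: "k \<in> H" "k \<noteq> \<one>" for k
  proof -
    obtain \<psi> where \<psi>: "\<psi> \<in> chars" "\<psi> k \<noteq> 1" using chars_separate_points[OF k] .
    define \<psi>' where "\<psi>' = (\<lambda>h\<in>H. inverse (\<psi> h))"
    have \<psi>': "\<psi>' \<in> chars" unfolding \<psi>'_def by (rule char_inverse[OF \<psi>(1)])
    have cancel: "(\<lambda>h\<in>H. a h * (\<lambda>h\<in>H. b h * \<phi> h) h) = \<phi>"
      if "\<phi> \<in> chars" "\<And>h. h \<in> H \<Longrightarrow> a h * b h = 1" for a b \<phi>
      using that by (auto simp: linear_chars_def extensional_def restrict_def fun_eq_iff
          mult.assoc[symmetric])
    have "\<psi> h * \<psi>' h = 1" "\<psi>' h * \<psi> h = 1" if "h \<in> H" for h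
      using that char_nonzero[OF \<psi>(1) that] by (simp_all add: \<psi>'_def)
    note cancel' = cancel[of _ \<psi> \<psi>', OF _ this(1)] cancel[of _ \<psi>' \<psi>, OF _ this(2)]
    have "(\<Sum>\<phi>\<in>chars. \<psi> k * \<phi> k) = (\<Sum>\<phi>\<in>chars. \<phi> k)"
    proof (rule sum.reindex_bij_witness[where i = "\<lambda>\<phi>. \<lambda>h\<in>H. \<psi>' h * \<phi> h"
          and j = "\<lambda>\<phi>. \<lambda>h\<in>H. \<psi> h * \<phi> h"])
      fix \<phi> assume \<phi>: "\<phi> \<in> chars"
      show "(\<lambda>h\<in>H. \<psi>' h * (\<lambda>h\<in>H. \<psi> h * \<phi> h) h) = \<phi>"
        "(\<lambda>h\<in>H. \<psi> h * (\<lambda>h\<in>H. \<psi>' h * \<phi> h) h) = \<phi>"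
        using cancel'[OF \<phi>] by simp_all
      show "(\<lambda>h\<in>H. \<psi> h * \<phi> h) \<in> chars" "(\<lambda>h\<in>H. \<psi>' h * \<phi> h) \<in> chars"
        by (intro char_prod \<phi> \<psi> \<psi>')+
      show "(\<lambda>h\<in>H. \<psi> h * \<phi> h) k = \<psi> k * \<phi> k" using k by simp
    qed
    thus ?thesis using \<psi>(2) by (simp add: sum_distrib_left[symmetric])
  qed
  have "(\<Sum>k\<in>H. \<Sum>\<phi>\<in>chars. \<phi> k) = (\<Sum>k\<in>H. if k = \<one> then (\<Sum>\<phi>\<in>chars. \<phi> \<one>) else 0)"
    by (intro sum.cong) (auto simp: zero)
  hence "(\<Sum>\<phi>\<in>chars. \<phi> \<one>) = (\<Sum>k\<in>H. \<Sum>\<phi>\<in>chars. \<phi> k)" by simp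
  also have "\<dots> = (\<Sum>\<phi>\<in>chars. if \<phi> = triv then of_nat (card H) else 0)"
    by (subst sum.swap) (simp add: sum_char_over_H)
  also have "\<dots> = of_nat (card H)" using triv_char finite_chars by simp
  finally show ?thesis using zero[OF assms] by simp
qed

section \<open>Character components of vectors in the group algebra\<close>

text \<open>
  Up to the factor \<open>card H\<close>, the value at \<open>x\<close> of \<open>u e\<^sub>\<gamma>\<close>, the \<open>\<gamma>\<close>-component of \<open>u\<close> under the right
  action of \<open>H\<close>.
\<close>

definition coset_coeff :: "('a \<Rightarrow> complex) \<Rightarrow> 'a \<Rightarrow> ('a \<Rightarrow> complex) \<Rightarrow> complex" where
  "coset_coeff u x \<gamma> = (\<Sum>k\<in>H. u (x \<otimes> k) * \<gamma> k)"

text \<open>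
  Up to the factor \<open>card H ^ 2\<close>, the value at \<open>z\<close> of \<open>e\<^sub>\<beta> v e\<^sub>\<gamma>\<close>.
\<close>

definition double_coeff ::
  "('a \<Rightarrow> complex) \<Rightarrow> ('a \<Rightarrow> complex) \<Rightarrow> ('a \<Rightarrow> complex) \<Rightarrow> 'a \<Rightarrow> complex" where
  "double_coeff v \<beta> \<gamma> z = (\<Sum>h\<in>H. \<beta> h * coset_coeff v (h \<otimes> z) \<gamma>)"

text \<open>
  The product \<open>u v\<close> of the group algebra, written as a single sum.
\<close>

definition conv :: "('a \<Rightarrow> complex) \<Rightarrow> ('a \<Rightarrow> complex) \<Rightarrow> 'a \<Rightarrow> complex" where
  "conv u v y = (\<Sum>x\<in>carrier G. u x * v (inv x \<otimes> y))"

lemma coset_coeff_translate: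
  assumes "\<gamma> \<in> chars" "x \<in> carrier G" "h \<in> H"
  shows "coset_coeff u (x \<otimes> h) \<gamma> * \<gamma> h = coset_coeff u x \<gamma>"
  using sum_H_translate[OF assms(3), of "\<lambda>k. u (x \<otimes> k) * \<gamma> k"] assms
  by (simp add: coset_coeff_def sum_distrib_left m_assoc char_mult mult_ac)

lemma double_coeff_translate_left:
  assumes "\<beta> \<in> chars" "z \<in> carrier G" "h \<in> H"
  shows "\<beta> h * double_coeff v \<beta> \<gamma> (h \<otimes> z) = double_coeff v \<beta> \<gamma> z"
proof -
  have "\<beta> h * double_coeff v \<beta> \<gamma> (h \<otimes> z) = (\<Sum>k\<in>H. \<beta> (h \<otimes> k) * coset_coeff v (h \<otimes> k \<otimes> z) \<gamma>)"
    unfolding double_coeff_def sum_distrib_left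
    by (intro sum.cong)
       (use assms H_commute[OF assms(3)] in \<open>simp_all add: char_mult m_assoc[symmetric]\<close>)
  thus ?thesis
    using sum_H_translate[OF assms(3), of "\<lambda>k. \<beta> k * coset_coeff v (k \<otimes> z) \<gamma>"]
    by (simp add: double_coeff_def)
qed

lemma double_coeff_translate_right:
  assumes "\<gamma> \<in> chars" "z \<in> carrier G" "k \<in> H"
  shows "double_coeff v \<beta> \<gamma> (z \<otimes> k) * \<gamma> k = double_coeff v \<beta> \<gamma> z"
  unfolding double_coeff_def sum_distrib_right
  by (intro sum.cong)
     (use assms coset_coeff_translate[OF assms(1) _ assms(3), of "_ \<otimes> z"]
       in \<open>simp_all add: m_assoc[symmetric] mult.assoc\<close>)

text \<open>
  The identity \<open>\<Sum>\<^sub>\<beta> u e\<^sub>\<beta> = u\<close>.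
\<close>

lemma sum_coset_coeff:
  assumes "x \<in> carrier G"
  shows "(\<Sum>\<beta>\<in>chars. coset_coeff u x \<beta>) = of_nat (card H) * u x"
proof -
  have "(\<Sum>\<beta>\<in>chars. coset_coeff u x \<beta>) = (\<Sum>k\<in>H. u (x \<otimes> k) * (\<Sum>\<beta>\<in>chars. \<beta> k))"
    unfolding coset_coeff_def by (subst sum.swap) (simp add: sum_distrib_left)
  also have "\<dots> = (\<Sum>k\<in>H. if k = \<one> then of_nat (card H) * u x else 0)"
    by (intro sum.cong) (use assms in \<open>auto simp: sum_over_chars\<close>)
  finally show ?thesis by simp
qed

lemma coset_coeff_conv:
  assumes "y \<in> carrier G"
  shows "coset_coeff (conv u v) y \<gamma> = (\<Sum>x\<in>carrier G. u x * coset_coeff v (inv x \<otimes> y) \<gamma>)"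
  unfolding coset_coeff_def conv_def sum_distrib_right sum_distrib_left
  by (subst sum.swap) (intro sum.cong; use assms in \<open>simp add: m_assoc mult.assoc\<close>)

text \<open>
  The identity \<open>u v e\<^sub>\<gamma> = \<Sum>\<^sub>\<beta> (u e\<^sub>\<beta>) (e\<^sub>\<beta> v e\<^sub>\<gamma>)\<close>: insert \<open>1 = \<Sum>\<^sub>\<beta> e\<^sub>\<beta>\<close> between the factors.
  The second idempotent \<open>e\<^sub>\<beta>\<close> appears by averaging the substitution \<open>x \<mapsto> x h\<close> over \<open>h \<in> H\<close>.
\<close>

lemma coset_coeff_conv_decomp:
  assumes y: "y \<in> carrier G"
  shows "of_nat (card H) ^ 2 * coset_coeff (conv u v) y \<gamma> =
    (\<Sum>\<beta>\<in>chars. \<Sum>x\<in>carrier G. coset_coeff u x \<beta> * double_coeff v \<beta> \<gamma> (inv x \<otimes> y))"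
proof -
  let ?V = "\<lambda>x. coset_coeff v (inv x \<otimes> y) \<gamma>"
  have "(\<Sum>x\<in>carrier G. coset_coeff u x \<beta> * double_coeff v \<beta> \<gamma> (inv x \<otimes> y))
      = of_nat (card H) * (\<Sum>x\<in>carrier G. coset_coeff u x \<beta> * ?V x)" if \<beta>: "\<beta> \<in> chars" for \<beta>
  proof -
    have inner: "(\<Sum>x\<in>carrier G. coset_coeff u x \<beta> * (\<beta> h * coset_coeff v (h \<otimes> (inv x \<otimes> y)) \<gamma>))
        = (\<Sum>x\<in>carrier G. coset_coeff u x \<beta> * ?V x)" if h: "h \<in> H" for h
    proof -
      have "(\<Sum>x\<in>carrier G. coset_coeff u x \<beta> * (\<beta> h * coset_coeff v (h \<otimes> (inv x \<otimes> y)) \<gamma>))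
        = (\<Sum>x\<in>carrier G. coset_coeff u (x \<otimes> h) \<beta> *
            (\<beta> h * coset_coeff v (h \<otimes> (inv (x \<otimes> h) \<otimes> y)) \<gamma>))"
        using h by (subst sum_carrier_right_translate[of h, symmetric]) simp_all
      also have "\<dots> = (\<Sum>x\<in>carrier G. coset_coeff u x \<beta> * ?V x)"
      proof (rule sum.cong[OF refl])
        fix x assume x: "x \<in> carrier G"
        have "h \<otimes> (inv (x \<otimes> h) \<otimes> y) = inv x \<otimes> y"
          using h x y by (simp add: inv_mult_group m_assoc[symmetric])
        thus "coset_coeff u (x \<otimes> h) \<beta> * (\<beta> h * coset_coeff v (h \<otimes> (inv (x \<otimes> h) \<otimes> y)) \<gamma>)
            = coset_coeff u x \<beta> * ?V x"
          using coset_coeff_translate[OF \<beta> x h, of u] by (simp add: mult.assoc[symmetric])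
      qed
      finally show ?thesis .
    qed
    show ?thesis
      unfolding double_coeff_def sum_distrib_left
      by (subst sum.swap) (simp add: inner sum_distrib_left)
  qed
  hence "(\<Sum>\<beta>\<in>chars. \<Sum>x\<in>carrier G. coset_coeff u x \<beta> * double_coeff v \<beta> \<gamma> (inv x \<otimes> y))
      = of_nat (card H) * (\<Sum>\<beta>\<in>chars. \<Sum>x\<in>carrier G. coset_coeff u x \<beta> * ?V x)"
    by (simp add: sum_distrib_left)
  also have "(\<Sum>\<beta>\<in>chars. \<Sum>x\<in>carrier G. coset_coeff u x \<beta> * ?V x)
      = (\<Sum>x\<in>carrier G. (\<Sum>\<beta>\<in>chars. coset_coeff u x \<beta>) * ?V x)"
    by (subst sum.swap) (simp add: sum_distrib_right)
  also have "\<dots> = of_nat (card H) * coset_coeff (conv u v) y \<gamma>"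
    by (simp add: sum_coset_coeff coset_coeff_conv[OF y] sum_distrib_left mult.assoc)
  finally show ?thesis by (simp add: power2_eq_square)
qed

text \<open>
  If \<open>u\<close> is supported on \<open>x H\<close>, then moving \<open>u\<close> by left translation with \<open>x h x\<^sup>-\<^sup>1\<close>, where \<open>h \<in> H\<close>,
  agrees with a right translation, because \<open>H\<close> is abelian. Averaging over \<open>h\<close> against \<open>\<beta>\<close> thus
  projects to the \<open>\<beta>\<close>-component, and this can be done after the multiplication by \<open>v\<close>.
\<close>

lemma double_coeff_extract:
  assumes \<beta>: "\<beta> \<in> chars" and x: "x \<in> carrier G" and z: "z \<in> carrier G"
    and supp: "\<And>y. y \<in> carrier G \<Longrightarrow> coset y \<noteq> coset x \<Longrightarrow> u y = 0"
  shows "(\<Sum>h\<in>H. \<beta> h * coset_coeff (conv u v) (x \<otimes> h \<otimes> z) \<gamma>)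
    = coset_coeff u x \<beta> * double_coeff v \<beta> \<gamma> z"
proof -
  let ?V = "\<lambda>g. coset_coeff v g \<gamma>"
  have expand: "coset_coeff (conv u v) (x \<otimes> h \<otimes> z) \<gamma> = (\<Sum>k\<in>H. u (x \<otimes> k) * ?V (inv k \<otimes> h \<otimes> z))"
    if h: "h \<in> H" for h
  proof -
    have "coset_coeff (conv u v) (x \<otimes> h \<otimes> z) \<gamma>
        = (\<Sum>y\<in>carrier G. u y * ?V (inv y \<otimes> (x \<otimes> h \<otimes> z)))"
      using x z h by (simp add: coset_coeff_conv)
    also have "\<dots> = (\<Sum>y\<in>coset x. u y * ?V (inv y \<otimes> (x \<otimes> h \<otimes> z)))"
      by (rule sum.mono_neutral_right)
         (use finite_carrier x l_coset_subset_G[OF H_subset x] supp in_coset_iff in auto)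
    also have "\<dots> = (\<Sum>k\<in>H. u (x \<otimes> k) * ?V (inv (x \<otimes> k) \<otimes> (x \<otimes> h \<otimes> z)))"
      by (rule sum_coset[OF x])
    also have "\<dots> = (\<Sum>k\<in>H. u (x \<otimes> k) * ?V (inv k \<otimes> h \<otimes> z))"
    proof (rule sum.cong[OF refl])
      fix k assume k: "k \<in> H"
      have "inv x \<otimes> (x \<otimes> (h \<otimes> z)) = h \<otimes> z"
        using x h z by (simp add: m_assoc[symmetric])
      hence "inv (x \<otimes> k) \<otimes> (x \<otimes> h \<otimes> z) = inv k \<otimes> h \<otimes> z"
        using x h z k by (simp add: inv_mult_group m_assoc)
      thus "u (x \<otimes> k) * ?V (inv (x \<otimes> k) \<otimes> (x \<otimes> h \<otimes> z)) = u (x \<otimes> k) * ?V (inv k \<otimes> h \<otimes> z)"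
        by simp
    qed
    finally show ?thesis .
  qed
  have collect: "(\<Sum>h\<in>H. \<beta> h * ?V (inv k \<otimes> h \<otimes> z)) = \<beta> k * double_coeff v \<beta> \<gamma> z" if k: "k \<in> H" for k
  proof -
    have "(\<Sum>h\<in>H. \<beta> h * ?V (inv k \<otimes> h \<otimes> z))
        = (\<Sum>h\<in>H. \<beta> (k \<otimes> h) * ?V (inv k \<otimes> (k \<otimes> h) \<otimes> z))"
      by (rule sum_H_translate[OF k, symmetric])
    thus ?thesis using k z \<beta>
      by (simp add: m_assoc[symmetric] char_mult double_coeff_def sum_distrib_left mult.assoc)
  qed
  have "(\<Sum>h\<in>H. \<beta> h * coset_coeff (conv u v) (x \<otimes> h \<otimes> z) \<gamma>)
      = (\<Sum>k\<in>H. u (x \<otimes> k) * (\<Sum>h\<in>H. \<beta> h * ?V (inv k \<otimes> h \<otimes> z)))"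
    by (simp add: expand sum_distrib_left) (subst sum.swap, simp add: mult.left_commute)
  also have "\<dots> = coset_coeff u x \<beta> * double_coeff v \<beta> \<gamma> z"
    by (simp add: collect) (simp add: coset_coeff_def[of u] sum_distrib_right mult.assoc)
  finally show ?thesis .
qed

section \<open>The orthogonality condition in terms of components\<close>

lemma sum_ga_mult:
  "(\<Sum>g\<in>carrier G. cnj (ga_mult G a b g) * f g)
    = (\<Sum>p\<in>carrier G. \<Sum>q\<in>carrier G. cnj (a p) * cnj (b q) * f (p \<otimes> q))"
proof -
  let ?S = "carrier G \<times> carrier G"
  have "cnj (ga_mult G a b g) * f g
      = (\<Sum>pq | pq \<in> ?S \<and> fst pq \<otimes> snd pq = g.
          cnj (a (fst pq)) * cnj (b (snd pq)) * f (fst pq \<otimes> snd pq))" for g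
  proof -
    have "{(p, q) \<in> ?S. p \<otimes> q = g} = {pq. pq \<in> ?S \<and> fst pq \<otimes> snd pq = g}" by auto
    thus ?thesis by (simp add: ga_mult_def case_prod_beta sum_distrib_right)
  qed
  hence "(\<Sum>g\<in>carrier G. cnj (ga_mult G a b g) * f g)
      = (\<Sum>pq\<in>?S. cnj (a (fst pq)) * cnj (b (snd pq)) * f (fst pq \<otimes> snd pq))"
    using finite_carrier
    by (simp only:) (subst sum.group, auto)
  thus ?thesis by (simp add: sum.cartesian_product case_prod_beta)
qed

text \<open>
  The idempotents are self-adjoint since characters are unitary, so they move to the other argument
  of the inner product.
\<close>

lemma ga_inner_char_idem:
  assumes \<beta>: "\<beta> \<in> chars" and \<gamma>: "\<gamma> \<in> chars" and x: "x \<in> carrier G"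
  shows "ga_inner G (ga_mult G (ga_mult G (char_idem G H \<beta>) (ga_basis x)) (char_idem G H \<gamma>)) v
    = double_coeff v \<beta> \<gamma> x / (of_nat (card (carrier G)) * of_nat (card H) ^ 2)"
proof -
  have idem: "(\<Sum>p\<in>carrier G. cnj (char_idem G H \<phi> p) * f p) = (\<Sum>h\<in>H. \<phi> h * f h) / of_nat (card H)"
    if "\<phi> \<in> chars" for \<phi> and f :: "'a \<Rightarrow> complex"
  proof -
    have "(\<Sum>p\<in>carrier G. cnj (char_idem G H \<phi> p) * f p) = (\<Sum>h\<in>H. cnj (char_idem G H \<phi> h) * f h)"
      by (rule sum.mono_neutral_right) (use finite_carrier H_subset in \<open>auto simp: char_idem_def\<close>)
    also have "\<dots> = (\<Sum>h\<in>H. \<phi> h * f h / of_nat (card H))"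
      by (intro sum.cong) (auto simp: char_idem_def cnj_char[OF that])
    finally show ?thesis by (simp add: sum_divide_distrib)
  qed
  have basis: "(\<Sum>q\<in>carrier G. cnj (ga_basis x q) * f q) = f x" for f :: "'a \<Rightarrow> complex"
  proof -
    have "(\<Sum>q\<in>carrier G. cnj (ga_basis x q) * f q) = (\<Sum>q\<in>carrier G. if q = x then f x else 0)"
      by (intro sum.cong) (auto simp: ga_basis_def)
    thus ?thesis using x finite_carrier by simp
  qed
  have "(\<Sum>g\<in>carrier G. cnj (ga_mult G (ga_mult G (char_idem G H \<beta>) (ga_basis x)) (char_idem G H \<gamma>) g) * v g)
    = (\<Sum>p\<in>carrier G. cnj (ga_mult G (char_idem G H \<beta>) (ga_basis x) p) *
        (\<Sum>q\<in>carrier G. cnj (char_idem G H \<gamma> q) * v (p \<otimes> q)))"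
    by (simp only: sum_ga_mult[of _ "char_idem G H \<gamma>"] sum_distrib_left mult.assoc)
  also have "\<dots> = (\<Sum>p\<in>carrier G. cnj (char_idem G H \<beta> p) *
        (\<Sum>r\<in>carrier G. cnj (ga_basis x r) * (\<Sum>q\<in>carrier G. cnj (char_idem G H \<gamma> q) * v (p \<otimes> r \<otimes> q))))"
    by (subst sum_ga_mult) (simp only: sum_distrib_left mult.assoc)
  also have "\<dots> = double_coeff v \<beta> \<gamma> x / of_nat (card H) ^ 2"
    by (simp add: basis idem[OF \<beta>] idem[OF \<gamma>] double_coeff_def coset_coeff_def power2_eq_square
        mult.commute[of "\<gamma> _"] flip: sum_divide_distrib)
  finally show ?thesis by (simp add: ga_inner_def)
qed

lemma ga_perp_span:
  "u \<in> ga_perp G (cfun.span S) \<longleftrightarrow> u \<in> group_algebra G \<and> (\<forall>s\<in>S. ga_inner G s u = 0)"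
proof -
  have "cfun.subspace {s. ga_inner G s u = 0}"
    by (auto simp: cfun.subspace_def ga_inner_def distrib_right sum.distrib mult.assoc
        simp flip: sum_distrib_left)
  hence "cfun.span S \<subseteq> {s. ga_inner G s u = 0}" if "\<forall>s\<in>S. ga_inner G s u = 0"
    using that by (intro cfun.span_minimal) auto
  thus ?thesis using cfun.span_base[of _ S] by (auto simp: ga_perp_def)
qed

text \<open>
  Shifting \<open>z\<close> by \<open>H\<close> on either side multiplies \<open>double_coeff v \<beta> \<gamma> z\<close> by values of characters, which
  are nonzero. So vanishing at one point of a double coset is the same as vanishing on all of it.
\<close>

lemma perp_W_space_iff:
  assumes P: "P \<subseteq> chars" and D: "double_coset_reps G H D" and v: "v \<in> group_algebra G"
  shows "v \<in> (\<Inter>x\<in>D. ga_perp G (W_space G H P x)) \<longleftrightarrow>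
    (\<forall>\<beta>\<in>P. \<forall>\<gamma>\<in>(chars - P) \<union> {triv}. (\<beta>, \<gamma>) \<noteq> (triv, triv) \<longrightarrow>
      (\<forall>z\<in>carrier G. double_coeff v \<beta> \<gamma> z = 0))"
proof -
  have DG: "D \<subseteq> carrier G" using D by (simp add: double_coset_reps_def)
  have nz: "of_nat (card (carrier G)) * of_nat (card H) ^ 2 \<noteq> (0::complex)"
    using card_H_pos finite_carrier one_closed by (auto simp: card_eq_0_iff)
  have "v \<in> (\<Inter>x\<in>D. ga_perp G (W_space G H P x)) \<longleftrightarrow>
    (\<forall>\<beta>\<in>P. \<forall>\<gamma>\<in>(chars - P) \<union> {triv}. (\<beta>, \<gamma>) \<noteq> (triv, triv) \<longrightarrow>
      (\<forall>z\<in>D. double_coeff v \<beta> \<gamma> z = 0))" (is "_ \<longleftrightarrow> ?R")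
  proof -
    have "ga_inner G (ga_mult G (ga_mult G (char_idem G H \<beta>) (ga_basis x)) (char_idem G H \<gamma>)) v = 0
        \<longleftrightarrow> double_coeff v \<beta> \<gamma> x = 0"
      if "\<beta> \<in> P" "\<gamma> \<in> (chars - P) \<union> {triv}" "x \<in> D" for \<beta> \<gamma> x
      using that P DG triv_char nz by (subst ga_inner_char_idem) auto
    thus ?thesis using v unfolding W_space_def by (simp only: INT_iff ga_perp_span) blast
  qed
  also have "\<dots> \<longleftrightarrow> (\<forall>\<beta>\<in>P. \<forall>\<gamma>\<in>(chars - P) \<union> {triv}. (\<beta>, \<gamma>) \<noteq> (triv, triv) \<longrightarrow>
      (\<forall>z\<in>carrier G. double_coeff v \<beta> \<gamma> z = 0))"
  proof (intro ball_cong[OF refl] imp_cong[OF refl])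
    fix \<beta> \<gamma> assume "\<beta> \<in> P" "\<gamma> \<in> (chars - P) \<union> {triv}"
    hence \<beta>: "\<beta> \<in> chars" and \<gamma>: "\<gamma> \<in> chars" using P triv_char by auto
    show "(\<forall>z\<in>D. double_coeff v \<beta> \<gamma> z = 0) \<longleftrightarrow> (\<forall>z\<in>carrier G. double_coeff v \<beta> \<gamma> z = 0)"
    proof
      assume zero: "\<forall>z\<in>D. double_coeff v \<beta> \<gamma> z = 0"
      show "\<forall>z\<in>carrier G. double_coeff v \<beta> \<gamma> z = 0"
      proof
        fix z assume z: "z \<in> carrier G"
        obtain x where x: "x \<in> D" "x \<in> H <#> (z <# H)"
          using D z unfolding double_coset_reps_def by blast
        then obtain h k where hk: "h \<in> H" "k \<in> H" "x = h \<otimes> z \<otimes> k"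
          using z by (auto simp: set_mult_def l_coset_def m_assoc[symmetric])
        have "double_coeff v \<beta> \<gamma> z = \<beta> h * (double_coeff v \<beta> \<gamma> x * \<gamma> k)"
          using double_coeff_translate_left[OF \<beta> z hk(1)]
            double_coeff_translate_right[OF \<gamma> _ hk(2), of "h \<otimes> z"] hk z by simp
        thus "double_coeff v \<beta> \<gamma> z = 0" using zero x(1) by simp
      qed
    qed (use DG in auto)
  qed
  finally show ?thesis .
qed

section \<open>The step matrix of the walk\<close>

lemma total_weight_pos: "weight G w \<Longrightarrow> 0 < (\<Sum>k\<in>carrier G. w k)"
  unfolding weight_def using finite_carrier by (metis order_le_less sum_pos2)

lemma sum_walk_step_right:
  assumes "weight G w" "x \<in> carrier G"
  shows "(\<Sum>y\<in>carrier G. walk_step G w x y) = 1"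
proof -
  have "(\<Sum>y\<in>carrier G. w (inv x \<otimes> y)) = (\<Sum>y\<in>carrier G. w y)"
    by (rule sum.reindex_bij_witness[where i = "\<lambda>y. x \<otimes> y" and j = "\<lambda>y. inv x \<otimes> y"])
       (use assms in \<open>auto simp: m_assoc[symmetric]\<close>)
  thus ?thesis using total_weight_pos[OF assms(1)]
    by (simp add: walk_step_def flip: sum_divide_distrib)
qed

lemma sum_walk_step_left:
  assumes "weight G w" "y \<in> carrier G"
  shows "(\<Sum>x\<in>carrier G. walk_step G w x y) = 1"
proof -
  have "(\<Sum>x\<in>carrier G. w (inv x \<otimes> y)) = (\<Sum>y\<in>carrier G. w y)"
    by (rule sum.reindex_bij_witness[where i = "\<lambda>g. y \<otimes> inv g" and j = "\<lambda>x. inv x \<otimes> y"])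
       (use assms in \<open>auto simp: m_assoc inv_mult_group mult_inv_cancel\<close>)
  thus ?thesis using total_weight_pos[OF assms(1)]
    by (simp add: walk_step_def flip: sum_divide_distrib)
qed

lemma walk_step_nonneg:
  "weight G w \<Longrightarrow> x \<in> carrier G \<Longrightarrow> y \<in> carrier G \<Longrightarrow> 0 \<le> walk_step G w x y"
  using total_weight_pos[of w] by (auto simp: walk_step_def weight_def intro!: divide_nonneg_pos)

section \<open>Existence of the walk\<close>

primrec partial_product :: "nat \<Rightarrow> (nat \<Rightarrow> 'a) \<Rightarrow> 'a" where
  "partial_product 0 \<omega> = \<omega> 0"
| "partial_product (Suc t) \<omega> = partial_product t \<omega> \<otimes> \<omega> (Suc t)"

definition increment :: "(nat \<Rightarrow> 'a) \<Rightarrow> nat \<Rightarrow> 'a" where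
  "increment xs i = (case i of 0 \<Rightarrow> xs 0 | Suc j \<Rightarrow> inv (xs j) \<otimes> xs i)"

lemma partial_product_eq_iff:
  assumes "\<And>i. \<omega> i \<in> carrier G" "\<And>i. i \<le> t \<Longrightarrow> xs i \<in> carrier G"
  shows "(\<forall>i\<le>t. partial_product i \<omega> = xs i) \<longleftrightarrow> (\<forall>i\<le>t. \<omega> i = increment xs i)"
  using assms(2)
proof (induction t)
  case (Suc t)
  have "partial_product (Suc t) \<omega> = xs (Suc t) \<longleftrightarrow> \<omega> (Suc t) = increment xs (Suc t)"
    if "partial_product t \<omega> = xs t"
    using that Suc.prems[of t] Suc.prems[of "Suc t"] assms(1)[of "Suc t"]
      mult_inv_cancel(1)[of "xs t" "xs (Suc t)"] mult_inv_cancel(2)[of "xs t" "\<omega> (Suc t)"]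
    by (auto simp: increment_def)
  moreover have "(\<forall>i\<le>t. partial_product i \<omega> = xs i) \<longleftrightarrow> (\<forall>i\<le>t. \<omega> i = increment xs i)"
    by (rule Suc.IH) (simp add: Suc.prems)
  ultimately show ?case by (auto simp: le_Suc_eq simp del: partial_product.simps)
qed (simp add: increment_def)

text \<open>
  The walk is realised as the sequence of partial products of independent factors: the first is
  distributed as \<open>\<alpha>\<close>, each later one proportionally to \<open>w\<close>. A path of the walk determines its
  factors, so its probability is a product.
\<close>

lemma exists_left_invariant_walk:
  assumes w: "weight G w" and \<alpha>: "set_pmf \<alpha> \<subseteq> carrier G"
  shows "\<exists>(M :: (nat \<Rightarrow> 'a) measure) X. left_invariant_walk G w \<alpha> M X"
proof -
  let ?S = "carrier G"
  define s where "s = (\<Sum>k\<in>?S. w k)"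
  have s: "s > 0" using total_weight_pos[OF w] by (simp add: s_def)
  define d where "d = (\<lambda>i g. if i = (0::nat) then pmf \<alpha> g else w g / s)"
  define N where "N i = point_measure ?S (d i)" for i
  have d_nonneg: "0 \<le> d i g" if "g \<in> ?S" for i g
    using that w s by (simp add: d_def weight_def)
  have d_sum: "(\<Sum>g\<in>?S. d i g) = 1" for i
    using s sum_pmf_eq_1[OF finite_carrier \<alpha>]
    by (cases "i = 0") (simp_all add: d_def s_def flip: sum_divide_distrib)
  have prob_N: "prob_space (N i)" for i
  proof
    show "emeasure (N i) (space (N i)) = 1"
      using d_sum[of i] d_nonneg finite_carrier
      by (simp add: N_def space_point_measure emeasure_point_measure_finite)
  qed
  have meas_N: "measure (N i) {g} = d i g" if "g \<in> ?S" for i g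
    using that finite_carrier d_nonneg by (simp add: N_def measure_point_measure_finite_if)
  define M where "M = PiM UNIV N"
  interpret product_prob_space N UNIV by (rule product_prob_spaceI[OF prob_N])
  have space_M: "\<omega> i \<in> ?S" if "\<omega> \<in> space M" for \<omega> i
    using that by (auto simp: M_def space_PiM N_def space_point_measure)
  have coord: "(\<lambda>\<omega>. \<omega> i) \<in> measurable M (count_space ?S)" for i
  proof -
    have "(\<lambda>\<omega>. \<omega> i) \<in> measurable M (N i)"
      unfolding M_def by (rule measurable_component_singleton) simp
    also have "measurable M (N i) = measurable M (count_space ?S)"
      by (rule measurable_cong_sets) (simp_all add: N_def sets_point_measure_count_space)
    finally show ?thesis .
  qed
  have meas_X: "partial_product t \<in> measurable M (count_space ?S)" for t
  proof (induction t)
    case 0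
    show ?case using coord[of 0] by simp
  next
    case (Suc t)
    have pair: "(\<lambda>\<omega>. (partial_product t \<omega>, \<omega> (Suc t))) \<in> measurable M (count_space (?S \<times> ?S))"
      using measurable_Pair[OF Suc coord[of "Suc t"]]
        pair_measure_countable[of ?S ?S] finite_carrier by (simp add: countable_finite)
    have mult: "(\<lambda>(a, b). a \<otimes> b) \<in> measurable (count_space (?S \<times> ?S)) (count_space ?S)"
      by auto
    show ?case using measurable_compose[OF pair mult] by simp
  qed
  have path: "\<P>(\<omega> in M. \<forall>i\<le>t. partial_product i \<omega> = xs i) = (\<Prod>i\<le>t. d i (increment xs i))"
    if xs: "\<And>i. i \<le> t \<Longrightarrow> xs i \<in> ?S" for t xs
  proof -
    have inc: "increment xs i \<in> ?S" if "i \<le> t" for i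
      using xs that by (auto simp: increment_def split: nat.split)
    have "(\<forall>i\<le>t. partial_product i \<omega> = xs i) \<longleftrightarrow> (\<forall>i\<in>{..t}. \<omega> i \<in> {increment xs i})"
      if "\<omega> \<in> space M" for \<omega>
      by (subst partial_product_eq_iff) (use space_M[OF that] xs in auto)
    hence "{\<omega> \<in> space M. \<forall>i\<le>t. partial_product i \<omega> = xs i}
        = {\<omega> \<in> space M. \<forall>i\<in>{..t}. \<omega> i \<in> {increment xs i}}"
      by blast
    also have "\<dots> = emb UNIV {..t} (\<Pi>\<^sub>E i\<in>{..t}. {increment xs i})"
      unfolding prod_emb_def M_def by (auto simp: space_PiM)
    also have "measure M \<dots> = (\<Prod>i\<le>t. measure (N i) {increment xs i})"
      unfolding M_def by (rule measure_PiM_emb) (use inc in \<open>auto simp: N_def sets_point_measure\<close>)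
    finally show ?thesis using inc by (simp add: meas_N)
  qed
  have step: "\<P>(\<omega> in M. partial_product (Suc t) \<omega> = y \<bar> \<forall>i\<le>t. partial_product i \<omega> = xs i)
      = walk_step G w (xs t) y"
    if xs: "\<forall>i\<le>t. xs i \<in> ?S" and y: "y \<in> ?S"
      and pos: "\<P>(\<omega> in M. \<forall>i\<le>t. partial_product i \<omega> = xs i) > 0" for t xs y
  proof -
    let ?ys = "xs(Suc t := y)"
    have "(\<forall>i\<le>Suc t. partial_product i \<omega> = ?ys i)
        \<longleftrightarrow> partial_product (Suc t) \<omega> = y \<and> (\<forall>i\<le>t. partial_product i \<omega> = xs i)" for \<omega>
      by (auto simp: le_Suc_eq)
    hence "\<P>(\<omega> in M. partial_product (Suc t) \<omega> = y \<and> (\<forall>i\<le>t. partial_product i \<omega> = xs i))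
        = \<P>(\<omega> in M. \<forall>i\<le>Suc t. partial_product i \<omega> = ?ys i)"
      by (simp only:)
    also have "\<dots> = (\<Prod>i\<le>Suc t. d i (increment ?ys i))"
      by (rule path) (use xs y in \<open>auto simp: le_Suc_eq\<close>)
    also have "\<dots> = (\<Prod>i\<le>t. d i (increment ?ys i)) * (w (inv (xs t) \<otimes> y) / s)"
      by (simp add: d_def increment_def)
    also have "(\<Prod>i\<le>t. d i (increment ?ys i)) = (\<Prod>i\<le>t. d i (increment xs i))"
      by (rule prod.cong) (auto simp: increment_def split: nat.split)
    also have "\<dots> = \<P>(\<omega> in M. \<forall>i\<le>t. partial_product i \<omega> = xs i)"
      by (rule path[symmetric]) (use xs in auto)
    finally show ?thesis using pos by (simp add: cond_prob_def walk_step_def s_def)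
  qed
  have init: "\<P>(\<omega> in M. partial_product 0 \<omega> = x) = pmf \<alpha> x" if "x \<in> ?S" for x
    using path[of 0 "\<lambda>_. x"] that by (simp add: d_def increment_def)
  have "prob_space M" unfolding M_def by (rule P.prob_space_axioms)
  hence "markov_chain_with M ?S (walk_step G w) partial_product"
    unfolding markov_chain_with_def
    using finite_carrier meas_X step walk_step_nonneg[OF w] sum_walk_step_right[OF w] by blast
  hence "left_invariant_walk G w \<alpha> M partial_product"
    using init unfolding left_invariant_walk_def by blast
  thus ?thesis by blast
qed

section \<open>Time averages and the uniform distribution\<close>

text \<open>
  Maximum principle. The value at \<open>y\<close> is a weighted average of the values at \<open>y \<otimes> inv g\<close>, where \<open>g\<close>
  runs over the support of \<open>w\<close>, so the set of maximum points is closed under right multiplication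
  by such \<open>inv g\<close>. In a finite group inverses are powers, and the support generates the group, so
  this set is closed under right multiplication by the whole group.
\<close>

lemma stationary_imp_constant:
  assumes w: "irreducible_weight G w"
    and stat: "\<And>y. y \<in> carrier G \<Longrightarrow> (\<Sum>x\<in>carrier G. A x * walk_step G w x y) = A y"
    and x: "x \<in> carrier G" and x': "x' \<in> carrier G"
  shows "A x = (A x' :: real)"
proof -
  have weight: "weight G w" using w by (simp add: irreducible_weight_def)
  define m where "m = Max (A ` carrier G)"
  have le_m: "A z \<le> m" if "z \<in> carrier G" for z using that finite_carrier by (simp add: m_def)
  have "m \<in> A ` carrier G" unfolding m_def using finite_carrier one_closed by (intro Max_in) auto
  then obtain y0 where y0: "y0 \<in> carrier G" "A y0 = m" by auto
  define K where "K = {g \<in> carrier G. \<forall>y\<in>carrier G. A y = m \<longrightarrow> A (y \<otimes> g) = m}"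
  have inv_K: "inv g \<in> K" if g: "g \<in> carrier G" "w g \<noteq> 0" for g
  proof -
    have "A (y \<otimes> inv g) = m" if y: "y \<in> carrier G" "A y = m" for y
    proof -
      have "(\<Sum>z\<in>carrier G. (m - A z) * walk_step G w z y) = 0"
        using stat[OF y(1)] sum_walk_step_left[OF weight y(1)] y(2)
        by (simp add: left_diff_distrib sum_subtractf flip: sum_distrib_left)
      hence "(m - A (y \<otimes> inv g)) * walk_step G w (y \<otimes> inv g) y = 0"
        using finite_carrier le_m walk_step_nonneg[OF weight _ y(1)] y g
        by (subst (asm) sum_nonneg_eq_0_iff) auto
      moreover have "walk_step G w (y \<otimes> inv g) y = w g / (\<Sum>k\<in>carrier G. w k)"
        using y g by (simp add: walk_step_def inv_mult_group m_assoc)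
      ultimately show ?thesis using g(2) total_weight_pos[OF weight] by simp
    qed
    thus ?thesis using g by (simp add: K_def)
  qed
  have K_mult: "g \<otimes> h \<in> K" if "g \<in> K" "h \<in> K" for g h
    using that by (auto simp: K_def m_assoc[symmetric])
  have K_one: "\<one> \<in> K" by (simp add: K_def)
  have K_pow: "g [^] (n::nat) \<in> K" if "g \<in> K" for g n
    by (induction n) (simp_all add: K_one K_mult that)
  have K_inv: "inv g \<in> K" if g: "g \<in> K" for g
  proof -
    have gG: "g \<in> carrier G" using g by (simp add: K_def)
    have "g [^] (Coset.order G - 1) \<otimes> g = \<one>"
      using pow_order_eq_1[OF gG] finite_carrier one_closed nat_pow_Suc[of g "Coset.order G - 1"]
      by (metis Suc_diff_1 order_gt_0_iff_finite)
    hence "inv g = g [^] (Coset.order G - 1)" using gG by (intro inv_equality) auto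
    thus ?thesis using K_pow[OF g] by simp
  qed
  have "g \<in> K" if "g \<in> generate G {g \<in> carrier G. w g \<noteq> 0}" for g
    using that
  proof (induction rule: generate.induct)
    case (incl h)
    thus ?case using K_inv[OF inv_K[of h]] by simp
  qed (auto intro: K_one inv_K K_mult)
  hence K_all: "g \<in> K" if "g \<in> carrier G" for g
    using that w by (simp add: irreducible_weight_def)
  have "A z = m" if z: "z \<in> carrier G" for z
  proof -
    have "A (y0 \<otimes> (inv y0 \<otimes> z)) = m" using K_all[of "inv y0 \<otimes> z"] y0 z by (simp add: K_def)
    thus ?thesis using y0 z by (simp add: m_assoc[symmetric])
  qed
  thus ?thesis using x x' by simp
qed

text \<open>
  A limit point of the time averages of the laws is stationary and has total mass \<open>1\<close>, hence is
  uniform. A linear condition satisfied at all times passes to the limit.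
\<close>

lemma functional_vanishes_at_uniform:
  fixes a :: "nat \<Rightarrow> 'a \<Rightarrow> real"
  assumes w: "irreducible_weight G w"
    and nonneg: "\<And>t x. x \<in> carrier G \<Longrightarrow> 0 \<le> a t x"
    and total: "\<And>t. (\<Sum>x\<in>carrier G. a t x) = 1"
    and step: "\<And>t y. y \<in> carrier G \<Longrightarrow> a (Suc t) y = (\<Sum>x\<in>carrier G. a t x * walk_step G w x y)"
    and zero: "\<And>t. (\<Sum>x\<in>carrier G. a t x * \<psi> x) = 0"
  shows "(\<Sum>x\<in>carrier G. \<psi> x) = 0"
proof -
  let ?S = "carrier G"
  define A where "A n x = (\<Sum>t<Suc n. a t x) / real (Suc n)" for n x
  have a_le: "a t x \<le> 1" if "x \<in> ?S" for t x
    using member_le_sum[OF that _ finite_carrier, of "a t"] nonneg total[of t] by auto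
  have A_bound: "\<bar>A n x\<bar> \<le> 1" if x: "x \<in> ?S" for n x
  proof -
    have "(\<Sum>t<Suc n. a t x) \<le> (\<Sum>t<Suc n. 1)" by (intro sum_mono a_le x)
    moreover have "0 \<le> (\<Sum>t<Suc n. a t x)" by (intro sum_nonneg nonneg x)
    ultimately show ?thesis by (simp add: A_def del: sum.lessThan_Suc)
  qed
  obtain l r where r: "strict_mono r" and lim: "\<And>x. x \<in> ?S \<Longrightarrow> (\<lambda>n. A (r n) x) \<longlonglongrightarrow> l x"
    by (rule bounded_functions_convergent_subsequence[OF finite_carrier, of A])
       (use A_bound in \<open>auto simp: bounded_iff intro!: exI[of _ 1]\<close>)
  have A_sum: "(\<Sum>x\<in>?S. A n x * f x) = (\<Sum>t<Suc n. \<Sum>x\<in>?S. a t x * f x) / real (Suc n)" for n f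
    unfolding A_def by (subst sum.swap) (simp add: sum_distrib_right sum_divide_distrib del: sum.lessThan_Suc)
  have stat: "(\<Sum>x\<in>?S. l x * walk_step G w x y) = l y" if y: "y \<in> ?S" for y
  proof -
    have diff: "(\<Sum>x\<in>?S. A n x * walk_step G w x y) - A n y = (a (Suc n) y - a 0 y) / real (Suc n)" for n
    proof -
      have "(\<Sum>t<Suc n. a (Suc t) y) - (\<Sum>t<Suc n. a t y) = a (Suc n) y - a 0 y"
        using sum_lessThan_telescope[of "\<lambda>t. a t y" "Suc n"] by (simp add: sum_subtractf del: sum.lessThan_Suc)
      moreover have "(\<Sum>x\<in>?S. A n x * walk_step G w x y) = (\<Sum>t<Suc n. a (Suc t) y) / real (Suc n)"
        by (simp only: A_sum step[OF y])
      ultimately show ?thesis by (simp only: A_def flip: diff_divide_distrib)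
    qed
    have "(\<lambda>n. (a (Suc n) y - a 0 y) / real (Suc n)) \<longlonglongrightarrow> 0"
    proof (rule Lim_null_comparison)
      show "eventually (\<lambda>n. norm ((a (Suc n) y - a 0 y) / real (Suc n)) \<le> 2 / real (Suc n)) sequentially"
      proof (intro always_eventually allI)
        fix n
        have "\<bar>a (Suc n) y - a 0 y\<bar> \<le> 2"
          using a_le[OF y, of "Suc n"] a_le[OF y, of 0] nonneg[OF y, of "Suc n"] nonneg[OF y, of 0]
          by linarith
        thus "norm ((a (Suc n) y - a 0 y) / real (Suc n)) \<le> 2 / real (Suc n)"
          by (simp add: divide_right_mono)
      qed
      show "(\<lambda>n. 2 / real (Suc n)) \<longlonglongrightarrow> 0"
        by (rule LIMSEQ_Suc[of "\<lambda>n. 2 / real n"]) (rule lim_const_over_n)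
    qed
    from LIMSEQ_subseq_LIMSEQ[OF this r]
    have "(\<lambda>n. (\<Sum>x\<in>?S. A (r n) x * walk_step G w x y) - A (r n) y) \<longlonglongrightarrow> 0"
      by (simp add: diff o_def)
    moreover have "(\<lambda>n. (\<Sum>x\<in>?S. A (r n) x * walk_step G w x y) - A (r n) y)
        \<longlonglongrightarrow> (\<Sum>x\<in>?S. l x * walk_step G w x y) - l y"
      by (intro tendsto_intros lim y)
    ultimately have "(\<Sum>x\<in>?S. l x * walk_step G w x y) - l y = 0" by (rule LIMSEQ_unique[rotated])
    thus ?thesis by simp
  qed
  have const: "l x = l \<one>" if "x \<in> ?S" for x
    by (rule stationary_imp_constant[OF w stat that one_closed])
  have "(\<lambda>n. \<Sum>x\<in>?S. A (r n) x * 1) \<longlonglongrightarrow> (\<Sum>x\<in>?S. l x * 1)"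
    by (intro tendsto_intros lim)
  moreover have "(\<Sum>x\<in>?S. A n x * 1) = 1" for n
    using A_sum[of n "\<lambda>_. 1"] total by simp
  ultimately have "(\<lambda>n. 1) \<longlonglongrightarrow> (\<Sum>x\<in>?S. l x)" by simp
  hence "(\<Sum>x\<in>?S. l x) = 1" by (simp add: LIMSEQ_const_iff)
  moreover have "(\<Sum>x\<in>?S. l x) = (\<Sum>x\<in>?S. l \<one>)" by (intro sum.cong refl const)
  ultimately have "l \<one> \<noteq> 0" by auto
  have "(\<lambda>n. \<Sum>x\<in>?S. A (r n) x * \<psi> x) \<longlonglongrightarrow> (\<Sum>x\<in>?S. l x * \<psi> x)"
    by (intro tendsto_intros lim)
  hence "(\<Sum>x\<in>?S. l x * \<psi> x) = 0"
    by (simp add: A_sum zero LIMSEQ_const_iff)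
  moreover have "(\<Sum>x\<in>?S. l x * \<psi> x) = (\<Sum>x\<in>?S. l \<one> * \<psi> x)"
    by (intro sum.cong refl arg_cong2[where f = "(*)"] const)
  ultimately have "l \<one> * (\<Sum>x\<in>?S. \<psi> x) = 0" by (simp add: sum_distrib_left)
  thus ?thesis using \<open>l \<one> \<noteq> 0\<close> by simp
qed

section \<open>Laws along paths of cosets\<close>

lemma coset_subset: "b \<in> lcosets H \<Longrightarrow> b \<subseteq> carrier G"
  using lcosets_subset_PowG[OF subgroup_H] by blast

lemma sum_over_lcosets: "(\<Sum>c\<in>lcosets H. \<Sum>y\<in>c. f y) = (\<Sum>y\<in>carrier G. f y)"
proof -
  have "(\<Sum>c\<in>lcosets H. \<Sum>y\<in>c. f y) = (\<Sum>c\<in>lcosets H. \<Sum>y | y \<in> carrier G \<and> coset y = c. f y)"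
    by (intro sum.cong refl) (use in_lcoset_iff coset_subset in auto)
  also have "\<dots> = (\<Sum>y\<in>carrier G. f y)"
    by (rule sum.group) (use finite_carrier in auto)
  finally show ?thesis .
qed

lemma conv_weight_vec:
  assumes w: "weight G w" and y: "y \<in> carrier G"
  shows "conv (\<lambda>x. of_real (u x)) (weight_vec G w) y
    = of_real (\<Sum>k\<in>carrier G. w k) * of_real (\<Sum>x\<in>carrier G. u x * walk_step G w x y)"
proof -
  have "conv (\<lambda>x. of_real (u x)) (weight_vec G w) y = (\<Sum>x\<in>carrier G. of_real (u x * w (inv x \<otimes> y)))"
    unfolding conv_def by (intro sum.cong) (use y in \<open>auto simp: weight_vec_def\<close>)
  also have "\<dots> = of_real (\<Sum>x\<in>carrier G. u x * w (inv x \<otimes> y))" by simp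
  also have "(\<Sum>x\<in>carrier G. u x * w (inv x \<otimes> y))
      = (\<Sum>k\<in>carrier G. w k) * (\<Sum>x\<in>carrier G. u x * walk_step G w x y)"
    unfolding sum_distrib_left[of "sum w _"] using total_weight_pos[OF w]
    by (simp add: walk_step_def)
  finally show ?thesis by (simp only: of_real_mult)
qed

abbreviation path_law ::
  "'m measure \<Rightarrow> (nat \<Rightarrow> 'm \<Rightarrow> 'a) \<Rightarrow> nat \<Rightarrow> (nat \<Rightarrow> 'a set) \<Rightarrow> 'a \<Rightarrow> complex" where
  "path_law M X t bs \<equiv> (\<lambda>x. of_real (image_path_law M X (\<lambda>x. coset x) t bs x))"

lemma path_law_outside: "coset x \<noteq> bs t \<Longrightarrow> path_law M X t bs x = 0"
  by (simp add: image_path_law_outside)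

lemma coset_coeff_path_law_Suc:
  assumes w: "weight G w" and mc: "markov_chain_with M (carrier G) (walk_step G w) X"
    and y: "y \<in> carrier G" "coset y = bs (Suc t)"
  shows "coset_coeff (conv (path_law M X t bs) (weight_vec G w)) y \<gamma>
    = of_real (\<Sum>k\<in>carrier G. w k) * coset_coeff (path_law M X (Suc t) bs) y \<gamma>"
proof -
  have "conv (path_law M X t bs) (weight_vec G w) (y \<otimes> k)
      = of_real (\<Sum>k\<in>carrier G. w k) * path_law M X (Suc t) bs (y \<otimes> k)" if k: "k \<in> H" for k
    using y k coset_mult_H[OF y(1) k]
    by (simp add: conv_weight_vec[OF w] image_path_law_Suc[OF mc] del: of_real_sum)
  thus ?thesis by (simp add: coset_coeff_def sum_distrib_left mult.assoc)
qed

lemma coset_coeff_path_law_outside: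
  assumes "y \<in> carrier G" "coset y \<noteq> bs t"
  shows "coset_coeff (path_law M X t bs) y \<gamma> = 0"
proof -
  have "path_law M X t bs (y \<otimes> k) = 0" if "k \<in> H" for k
    by (rule path_law_outside) (simp add: coset_mult_H assms that)
  thus ?thesis by (simp add: coset_coeff_def)
qed

lemma coset_coeff_path_law_triv:
  assumes mc: "markov_chain_with M (carrier G) p X" and y: "y \<in> carrier G" "coset y = bs t"
  shows "coset_coeff (path_law M X t bs) y triv = of_real (\<P>(\<omega> in M. \<forall>i\<le>t. coset (X i \<omega>) = bs i))"
proof -
  let ?u = "image_path_law M X (\<lambda>x. coset x) t bs"
  have "\<P>(\<omega> in M. \<forall>i\<le>t. coset (X i \<omega>) = bs i) = (\<Sum>x\<in>carrier G. ?u x)"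
    by (rule prob_image_path[OF mc])
  also have "\<dots> = (\<Sum>x\<in>coset y. ?u x)"
  proof (rule sum.mono_neutral_right[OF finite_carrier l_coset_subset_G[OF H_subset y(1)]], rule ballI)
    fix x assume "x \<in> carrier G - coset y"
    hence "coset x \<noteq> bs t" using in_coset_iff[OF y(1), of x] y(2) by auto
    thus "?u x = 0" by (rule image_path_law_outside)
  qed
  also have "\<dots> = (\<Sum>k\<in>H. ?u (y \<otimes> k))" by (rule sum_coset[OF y(1)])
  finally show ?thesis by (simp add: coset_coeff_def)
qed

section \<open>Weak lumping gives the set of characters\<close>

text \<open>
  Both sides come from one linear condition: the mass sent from \<open>b\<close> to \<open>c\<close> is \<open>q b c\<close> times the mass
  of \<open>b\<close>. It holds for the law of the walk at each time, and therefore for the uniform distribution.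
\<close>

lemma lumped_transition_uniform:
  assumes w: "irreducible_weight G w" and mc: "markov_chain_with M (carrier G) (walk_step G w) X"
    and lumped: "markov_chain_with M (lcosets H) q (\<lambda>t \<omega>. coset (X t \<omega>))"
    and b: "b \<in> lcosets H" and c: "c \<in> lcosets H"
  shows "(\<Sum>x\<in>b. \<Sum>y\<in>c. walk_step G w x y) = of_nat (card H) * q b c"
proof -
  interpret prob_space M by (rule markov_chainD[OF mc])
  note [measurable] = markov_chainD(3)[OF mc]
  note bG = coset_subset[OF b] and cG = coset_subset[OF c]
  have meas_in: "{\<omega> \<in> space M. X t \<omega> \<in> d} \<in> sets M" if "d \<subseteq> carrier G" for t d
    using measurable_sets[OF markov_chainD(3)[OF mc, of t], of d] that
    by (simp add: vimage_def Int_def conj_commute)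
  define a where "a t x = \<P>(\<omega> in M. X t \<omega> = x)" for t x
  define \<psi> where "\<psi> x = (if x \<in> b then (\<Sum>y\<in>c. walk_step G w x y) - q b c else 0)" for x
  have sum_b: "(\<Sum>x\<in>carrier G. f x * \<psi> x) = (\<Sum>x\<in>b. f x * ((\<Sum>y\<in>c. walk_step G w x y) - q b c))" for f
  proof -
    have "(\<Sum>x\<in>carrier G. f x * \<psi> x) = (\<Sum>x\<in>b. f x * \<psi> x)"
      by (rule sum.mono_neutral_right) (use finite_carrier bG in \<open>auto simp: \<psi>_def\<close>)
    thus ?thesis by (simp add: \<psi>_def)
  qed
  have joint: "\<P>(\<omega> in M. X t \<omega> = x \<and> X (Suc t) \<omega> = y) = a t x * walk_step G w x y"
    if "y \<in> carrier G" for t x y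
    using markov_event_step[OF mc, of t "\<lambda>_. True" y x] that by (simp add: a_def)
  have in_coset: "(X t \<omega> \<in> d) = (coset (X t \<omega>) = d)" if "\<omega> \<in> space M" "d \<in> lcosets H" for t \<omega> d
    using in_lcoset_iff[OF that(2)] markov_chain_in_states[OF mc that(1)] by blast
  have "(\<Sum>x\<in>carrier G. \<psi> x) = 0"
  proof (rule functional_vanishes_at_uniform[OF w])
    show "0 \<le> a t x" for t x by (simp add: a_def)
    show "(\<Sum>x\<in>carrier G. a t x) = 1" for t
      using prob_sum_over_states[OF mc, of "\<lambda>_. True" t] by (simp add: a_def prob_space)
    show "a (Suc t) y = (\<Sum>x\<in>carrier G. a t x * walk_step G w x y)" if y: "y \<in> carrier G" for t y
    proof -
      have "a (Suc t) y = (\<Sum>x\<in>carrier G. \<P>(\<omega> in M. X (Suc t) \<omega> = y \<and> X t \<omega> = x))"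
        unfolding a_def by (rule prob_sum_over_states[OF mc]) measurable
      thus ?thesis by (simp add: joint[OF y, symmetric] conj_commute)
    qed
    show "(\<Sum>x\<in>carrier G. a t x * \<psi> x) = 0" for t
    proof -
      have one: "\<P>(\<omega> in M. coset (X t \<omega>) = b) = (\<Sum>x\<in>b. a t x)"
      proof -
        have "\<P>(\<omega> in M. coset (X t \<omega>) = b) = \<P>(\<omega> in M. True \<and> X t \<omega> \<in> b)"
          by (intro arg_cong[where f = prob] Collect_cong) (use in_coset[OF _ b] in auto)
        thus ?thesis using prob_split_state[OF mc, of "\<lambda>_. True" b t] bG by (simp add: a_def)
      qed
      have "\<P>(\<omega> in M. coset (X t \<omega>) = b) * q b c
          = \<P>(\<omega> in M. coset (X t \<omega>) = b \<and> coset (X (Suc t) \<omega>) = c)"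
        using markov_event_step[OF lumped, of t "\<lambda>_. True" c b] c by simp
      also have "\<dots> = \<P>(\<omega> in M. X t \<omega> \<in> b \<and> X (Suc t) \<omega> \<in> c)"
        by (intro arg_cong[where f = prob] Collect_cong) (use in_coset[OF _ b] in_coset[OF _ c] in auto)
      also have "\<dots> = (\<Sum>y\<in>c. \<P>(\<omega> in M. X t \<omega> \<in> b \<and> X (Suc t) \<omega> = y))"
        by (rule prob_split_state[OF mc meas_in[OF bG] cG])
      also have "\<dots> = (\<Sum>y\<in>c. \<P>(\<omega> in M. X (Suc t) \<omega> = y \<and> X t \<omega> \<in> b))"
        by (simp add: conj_commute)
      also have "\<dots> = (\<Sum>y\<in>c. \<Sum>x\<in>b. \<P>(\<omega> in M. X (Suc t) \<omega> = y \<and> X t \<omega> = x))"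
        by (intro sum.cong refl prob_split_state[OF mc _ bG]) measurable
      also have "\<dots> = (\<Sum>y\<in>c. \<Sum>x\<in>b. a t x * walk_step G w x y)"
        by (intro sum.cong refl) (use joint cG in \<open>auto simp: conj_commute\<close>)
      also have "\<dots> = (\<Sum>x\<in>b. a t x * (\<Sum>y\<in>c. walk_step G w x y))"
        by (subst sum.swap) (simp add: sum_distrib_left)
      finally show ?thesis
        unfolding sum_b one by (simp add: right_diff_distrib sum_subtractf sum_distrib_right)
    qed
  qed
  hence "(\<Sum>x\<in>b. (\<Sum>y\<in>c. walk_step G w x y) - q b c) = 0" using sum_b[of "\<lambda>_. 1"] by simp
  thus ?thesis
    using l_card_cosets_equal[OF b H_subset finite_carrier] by (simp add: sum_subtractf)
qed

text \<open>
  By left invariance of the step matrix, the uniform distribution on \<open>coset x\<close> gives transition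
  probabilities that are unchanged when \<open>x\<close> and the target are both translated by \<open>x h x\<^sup>-\<^sup>1\<close>.
  This translation maps \<open>coset x\<close> to itself.
\<close>

lemma lumped_transition_twist_invariant:
  assumes w: "irreducible_weight G w" and mc: "markov_chain_with M (carrier G) (walk_step G w) X"
    and lumped: "markov_chain_with M (lcosets H) q (\<lambda>t \<omega>. coset (X t \<omega>))"
    and x: "x \<in> carrier G" and z: "z \<in> carrier G" and h: "h \<in> H"
  shows "q (coset x) (coset (x \<otimes> h \<otimes> z)) = q (coset x) (coset (x \<otimes> z))"
proof -
  have q: "of_nat (card H) * q (coset x) (coset (x \<otimes> g))
      = (\<Sum>k\<in>H. \<Sum>l\<in>H. walk_step G w (x \<otimes> k) (x \<otimes> g \<otimes> l))" if g: "g \<in> carrier G" for g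
    using lumped_transition_uniform[OF w mc lumped, of "coset x" "coset (x \<otimes> g)"] x g
    by (simp add: sum_coset)
  have cancel: "walk_step G w (x \<otimes> k) (x \<otimes> g) = w (inv k \<otimes> g) / (\<Sum>k\<in>carrier G. w k)"
    if "k \<in> H" "g \<in> carrier G" for k g
    using that x by (simp add: walk_step_def inv_mult_group m_assoc mult_inv_cancel)
  have "of_nat (card H) * q (coset x) (coset (x \<otimes> (h \<otimes> z)))
      = (\<Sum>k\<in>H. \<Sum>l\<in>H. walk_step G w (x \<otimes> (h \<otimes> k)) (x \<otimes> (h \<otimes> z) \<otimes> l))"
    using h z by (simp add: q sum_H_translate[OF h, of "\<lambda>k. \<Sum>l\<in>H. walk_step G w (x \<otimes> k) (x \<otimes> (h \<otimes> z) \<otimes> l)"])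
  also have "\<dots> = (\<Sum>k\<in>H. \<Sum>l\<in>H. walk_step G w (x \<otimes> k) (x \<otimes> z \<otimes> l))"
  proof (intro sum.cong refl)
    fix k l assume kl: "k \<in> H" "l \<in> H"
    have "inv (h \<otimes> k) \<otimes> (h \<otimes> (z \<otimes> l)) = inv k \<otimes> (z \<otimes> l)"
      using h kl z by (simp add: inv_mult_group m_assoc mult_inv_cancel)
    thus "walk_step G w (x \<otimes> (h \<otimes> k)) (x \<otimes> (h \<otimes> z) \<otimes> l) = walk_step G w (x \<otimes> k) (x \<otimes> z \<otimes> l)"
      using cancel[of "h \<otimes> k" "h \<otimes> (z \<otimes> l)"] cancel[of k "z \<otimes> l"] x h kl z by (simp add: m_assoc)
  qed
  also have "\<dots> = of_nat (card H) * q (coset x) (coset (x \<otimes> z))" by (simp add: q z)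
  finally show ?thesis using card_H_pos H_closed(3) x h z by (auto simp: m_assoc)
qed

lemma lumps_weakly_imp_chars:
  assumes w: "irreducible_weight G w" and lumps: "lumps_weakly G H w"
  shows "\<exists>P\<subseteq>chars. triv \<in> P \<and>
    (\<forall>\<beta>\<in>P. \<forall>\<gamma>\<in>(chars - P) \<union> {triv}. (\<beta>, \<gamma>) \<noteq> (triv, triv) \<longrightarrow>
      (\<forall>z\<in>carrier G. double_coeff (weight_vec G w) \<beta> \<gamma> z = 0))"
proof -
  obtain \<alpha> and M :: "(nat \<Rightarrow> 'a) measure" and X q
    where mc: "markov_chain_with M (carrier G) (walk_step G w) X"
      and lumped: "markov_chain_with M (lcosets H) q (\<lambda>t \<omega>. coset (X t \<omega>))"
    using lumps unfolding lumps_weakly_def left_invariant_walk_def time_homogeneous_markov_chain_def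
    by blast
  interpret prob_space M by (rule markov_chainD[OF mc])
  have weight: "weight G w" using w by (simp add: irreducible_weight_def)
  let ?U = "path_law M X" and ?v = "weight_vec G w" and ?s = "\<Sum>k\<in>carrier G. w k"
  define P where "P = {\<beta> \<in> chars. \<exists>t bs x. x \<in> carrier G \<and> coset_coeff (?U t bs) x \<beta> \<noteq> 0}"
  have "triv \<in> P"
  proof -
    have "(\<Sum>x\<in>carrier G. \<P>(\<omega> in M. X 0 \<omega> = x)) \<noteq> 0"
      using prob_sum_over_states[OF mc, of "\<lambda>_. True" 0] by (simp add: prob_space)
    then obtain x where x: "x \<in> carrier G" "\<P>(\<omega> in M. X 0 \<omega> = x) \<noteq> 0" by (meson sum.neutral)
    let ?bs = "\<lambda>_. coset x"
    have "0 < \<P>(\<omega> in M. X 0 \<omega> = x)" using x(2) by (simp add: zero_less_measure_iff)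
    also have "\<dots> = image_path_law M X (\<lambda>x. coset x) 0 ?bs x" by (simp add: image_path_law_0)
    also have "\<dots> \<le> \<P>(\<omega> in M. \<forall>i\<le>0. coset (X i \<omega>) = ?bs i)"
      unfolding image_path_law_def by (rule finite_measure_mono[OF _ image_path_measurable[OF mc]]) auto
    finally have "coset_coeff (?U 0 ?bs) x triv \<noteq> 0"
      using coset_coeff_path_law_triv[OF mc x(1), of ?bs 0] by simp
    thus ?thesis using x(1) triv_char unfolding P_def by blast
  qed
  moreover have "double_coeff ?v \<beta> \<gamma> z = 0"
    if \<beta>: "\<beta> \<in> P" and \<gamma>: "\<gamma> \<in> (chars - P) \<union> {triv}" "(\<beta>, \<gamma>) \<noteq> (triv, triv)" and z: "z \<in> carrier G" for \<beta> \<gamma> z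
  proof -
    have \<beta>_char: "\<beta> \<in> chars" using \<beta> by (simp add: P_def)
    obtain t bs x where x: "x \<in> carrier G" and nz: "coset_coeff (?U t bs) x \<beta> \<noteq> 0"
      using \<beta> unfolding P_def by blast
    have bs_t: "bs t = coset x"
      using nz coset_coeff_path_law_outside[OF x, of bs t] by metis
    \<comment> \<open>Extending the path by the coset of \<open>y\<close>, for each \<open>y\<close> separately, makes every value of the
      product with the weight part of the law along some path.\<close>
    have law: "coset_coeff (conv (?U t bs) ?v) y \<gamma>'
        = of_real ?s * coset_coeff (?U (Suc t) (bs(Suc t := coset y))) y \<gamma>'"
      if y: "y \<in> carrier G" for y \<gamma>'
    proof -
      have "?U t (bs(Suc t := coset y)) = ?U t bs"
        by (intro ext arg_cong[where f = of_real] image_path_law_cong) simp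
      thus ?thesis using coset_coeff_path_law_Suc[OF weight mc y, of "bs(Suc t := coset y)" t] by simp
    qed
    have "(\<Sum>h\<in>H. \<beta> h * coset_coeff (conv (?U t bs) ?v) (x \<otimes> h \<otimes> z) \<gamma>)
        = coset_coeff (?U t bs) x \<beta> * double_coeff ?v \<beta> \<gamma> z"
      by (rule double_coeff_extract[OF \<beta>_char x z]) (simp add: bs_t image_path_law_outside)
    moreover have "(\<Sum>h\<in>H. \<beta> h * coset_coeff (conv (?U t bs) ?v) (x \<otimes> h \<otimes> z) \<gamma>) = 0"
    proof (cases "\<gamma> = triv")
      case False
      hence "\<gamma> \<in> chars" "\<gamma> \<notin> P" using \<gamma> by auto
      hence "coset_coeff (?U t' bs') y \<gamma> = 0" if "y \<in> carrier G" for t' bs' y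
        using that unfolding P_def by blast
      thus ?thesis using x z by (intro sum.neutral) (simp add: law)
    next
      case True
      let ?p = "\<P>(\<omega> in M. \<forall>i\<le>t. coset (X i \<omega>) = bs i)"
      \<comment> \<open>A law that is not zero comes from a path that is actually observed, hence a path of cosets.\<close>
      have bs: "bs i \<in> lcosets H" if i: "i \<le> t" for i
      proof -
        obtain y where "image_path_law M X (\<lambda>x. coset x) t bs y \<noteq> 0"
          using nz unfolding coset_coeff_def by (metis (no_types, lifting) mult_zero_left of_real_0 sum.neutral)
        hence "{\<omega> \<in> space M. (\<forall>i\<le>t. coset (X i \<omega>) = bs i) \<and> X t \<omega> = y} \<noteq> {}"
          unfolding image_path_law_def by (metis measure_empty)
        then obtain \<omega> where "\<omega> \<in> space M" "coset (X i \<omega>) = bs i" using i by blast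
        thus ?thesis using coset_in_lcosets[OF markov_chain_in_states[OF mc, of \<omega> i]] by simp
      qed
      have mass: "coset_coeff (conv (?U t bs) ?v) y triv = of_real (?s * ?p * q (coset x) (coset y))"
        if y: "y \<in> carrier G" for y
      proof -
        let ?bs = "bs(Suc t := coset y)"
        have "(\<forall>i\<le>Suc t. coset (X i \<omega>) = ?bs i)
            \<longleftrightarrow> (\<forall>i\<le>t. coset (X i \<omega>) = bs i) \<and> coset (X (Suc t) \<omega>) = coset y" for \<omega>
          by (auto simp: le_Suc_eq)
        hence "\<P>(\<omega> in M. \<forall>i\<le>Suc t. coset (X i \<omega>) = ?bs i) = ?p * q (bs t) (coset y)"
          using markov_path_step[OF lumped bs coset_in_lcosets[OF y]] by (simp only:)
        thus ?thesis
          using law[OF y, of triv] coset_coeff_path_law_triv[OF mc y, of ?bs "Suc t"] bs_t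
          by (simp only: fun_upd_same of_real_mult mult.assoc)
      qed
      have "(\<Sum>h\<in>H. \<beta> h * coset_coeff (conv (?U t bs) ?v) (x \<otimes> h \<otimes> z) triv)
          = (\<Sum>h\<in>H. \<beta> h * of_real (?s * ?p * q (coset x) (coset (x \<otimes> z))))"
        by (intro sum.cong refl, subst mass)
           (use x z lumped_transition_twist_invariant[OF w mc lumped x z] in auto)
      also have "\<dots> = (\<Sum>h\<in>H. \<beta> h) * of_real (?s * ?p * q (coset x) (coset (x \<otimes> z)))"
        by (simp only: sum_distrib_right)
      also have "(\<Sum>h\<in>H. \<beta> h) = 0" using sum_char_over_H[OF \<beta>_char] \<gamma>(2) True by auto
      finally show ?thesis using True by simp
    qed
    ultimately show ?thesis using nz by simp
  qed
  ultimately show ?thesis by (intro exI[of _ P]) (auto simp: P_def)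
qed

section \<open>The set of characters gives weak lumping\<close>

text \<open>
  Only the summand of the trivial character survives in \<open>coset_coeff_conv_decomp\<close>, and it knows \<open>u\<close>
  only through the masses of the cosets.
\<close>

lemma coset_mass_conv:
  assumes y: "y \<in> carrier G"
    and vanish: "\<And>\<beta> x z. \<beta> \<in> chars \<Longrightarrow> \<beta> \<noteq> triv \<Longrightarrow> x \<in> carrier G \<Longrightarrow> z \<in> carrier G \<Longrightarrow>
      coset_coeff u x \<beta> * double_coeff v \<beta> triv z = 0"
  shows "of_nat (card H) ^ 2 * coset_coeff (conv u v) y triv
    = (\<Sum>x\<in>carrier G. coset_coeff u x triv * double_coeff v triv triv (inv x \<otimes> y))"
proof -
  have "(\<Sum>\<beta>\<in>chars. \<Sum>x\<in>carrier G. coset_coeff u x \<beta> * double_coeff v \<beta> triv (inv x \<otimes> y))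
    = (\<Sum>\<beta>\<in>{triv}. \<Sum>x\<in>carrier G. coset_coeff u x \<beta> * double_coeff v \<beta> triv (inv x \<otimes> y))"
    by (rule sum.mono_neutral_right)
       (use finite_chars triv_char y in \<open>auto intro!: sum.neutral simp: vanish simp del: mult_eq_0_iff\<close>)
  thus ?thesis using coset_coeff_conv_decomp[OF y] by simp
qed

lemma coset_coeff_indicator:
  assumes x: "x \<in> carrier G" and \<beta>: "\<beta> \<in> chars"
  shows "coset_coeff (\<lambda>x. of_real (if coset x = b then c else 0)) x \<beta>
    = (if coset x = b \<and> \<beta> = triv then of_real c * of_nat (card H) else 0)"
proof -
  have "coset_coeff (\<lambda>x. of_real (if coset x = b then c else 0)) x \<beta>
      = (\<Sum>k\<in>H. of_real (if coset x = b then c else 0) * \<beta> k)"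
    unfolding coset_coeff_def by (intro sum.cong refl) (simp add: coset_mult_H x)
  thus ?thesis using sum_char_over_H[OF \<beta>] by (simp flip: sum_distrib_left)
qed

text \<open>
  By induction along a path of cosets, the laws started from the uniform distribution have
  components only in \<open>P\<close>. So a step treats the law on a coset like the uniform distribution on this
  coset with the same mass, and the transition matrix \<open>q\<close> is the one given by the uniform distribution.
\<close>

lemma chars_imp_lumps_weakly:
  assumes weight: "weight G w" and P: "P \<subseteq> chars" "triv \<in> P"
    and perp: "\<And>\<beta> \<gamma> z. \<beta> \<in> P \<Longrightarrow> \<gamma> \<in> (chars - P) \<union> {triv} \<Longrightarrow> (\<beta>, \<gamma>) \<noteq> (triv, triv) \<Longrightarrow>
      z \<in> carrier G \<Longrightarrow> double_coeff (weight_vec G w) \<beta> \<gamma> z = 0"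
  shows "lumps_weakly G H w"
proof -
  let ?\<alpha> = "pmf_of_set (carrier G)"
  have ne: "carrier G \<noteq> {}" using one_closed by blast
  have \<alpha>: "set_pmf ?\<alpha> \<subseteq> carrier G" using finite_carrier ne by simp
  obtain M :: "(nat \<Rightarrow> 'a) measure" and X where walk: "left_invariant_walk G w ?\<alpha> M X"
    using exists_left_invariant_walk[OF weight \<alpha>] by blast
  have mc: "markov_chain_with M (carrier G) (walk_step G w) X"
    and init: "\<And>x. x \<in> carrier G \<Longrightarrow> \<P>(\<omega> in M. X 0 \<omega> = x) = 1 / of_nat (card (carrier G))"
    using walk finite_carrier ne by (auto simp: left_invariant_walk_def)
  interpret prob_space M by (rule markov_chainD[OF mc])
  let ?U = "path_law M X" and ?v = "weight_vec G w" and ?s = "\<Sum>k\<in>carrier G. w k"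
  have s: "?s > 0" by (rule total_weight_pos[OF weight])
  have invariant: "coset_coeff (?U t bs) y \<gamma> = 0"
    if "\<gamma> \<in> chars" "\<gamma> \<notin> P" "y \<in> carrier G" for t bs \<gamma> y
    using that
  proof (induction t arbitrary: y \<gamma>)
    case 0
    have "coset_coeff (?U 0 bs) y \<gamma>
        = coset_coeff (\<lambda>x. of_real (if coset x = bs 0 then 1 / of_nat (card (carrier G)) else 0)) y \<gamma>"
      unfolding coset_coeff_def using 0 by (intro sum.cong refl) (simp add: image_path_law_0 init)
    thus ?case using coset_coeff_indicator[OF 0(3,1), of "bs 0"] 0(2) P(2) by auto
  next
    case (Suc t)
    show ?case
    proof (cases "coset y = bs (Suc t)")
      case True
      have "coset_coeff (?U t bs) x \<beta> * double_coeff ?v \<beta> \<gamma> z = 0"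
        if "\<beta> \<in> chars" "x \<in> carrier G" "z \<in> carrier G" for \<beta> x z
      proof (cases "\<beta> \<in> P")
        case True
        hence "(\<beta>, \<gamma>) \<noteq> (triv, triv)" using Suc.prems(2) by auto
        thus ?thesis using perp[OF True, of \<gamma> z] Suc.prems that by simp
      qed (use Suc.IH that in simp)
      hence "of_nat (card H) ^ 2 * coset_coeff (conv (?U t bs) ?v) y \<gamma> = 0"
        unfolding coset_coeff_conv_decomp[OF Suc.prems(3)]
        by (intro sum.neutral ballI) (use Suc.prems(3) in simp)
      hence "coset_coeff (conv (?U t bs) ?v) y \<gamma> = 0" using H_closed(3) by auto
      thus ?thesis using coset_coeff_path_law_Suc[OF weight mc Suc.prems(3), of bs t \<gamma>] True s
        by (simp flip: of_real_sum)
    qed (use coset_coeff_path_law_outside Suc.prems(3) in blast)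
  qed
  have vanish: "coset_coeff (?U t bs) x \<beta> * double_coeff ?v \<beta> triv z = 0"
    if "\<beta> \<in> chars" "\<beta> \<noteq> triv" "x \<in> carrier G" "z \<in> carrier G" for t bs \<beta> x z
    using that perp[of \<beta> triv z] invariant[of \<beta> x] by (cases "\<beta> \<in> P") auto
  define q where "q b c = (\<Sum>x\<in>b. \<Sum>y\<in>c. walk_step G w x y) / of_nat (card H)" for b c
  have step: "\<P>(\<omega> in M. \<forall>i\<le>Suc t. coset (X i \<omega>) = bs i)
      = \<P>(\<omega> in M. \<forall>i\<le>t. coset (X i \<omega>) = bs i) * q (bs t) (bs (Suc t))"
    if bs: "bs t \<in> lcosets H" "bs (Suc t) \<in> lcosets H" for t bs
  proof -
    let ?b = "bs t" and ?c = "bs (Suc t)" and ?p = "\<lambda>t. \<P>(\<omega> in M. \<forall>i\<le>t. coset (X i \<omega>) = bs i)"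
    \<comment> \<open>The law on \<open>?b\<close> has the same trivial component as a multiple of the indicator of \<open>?b\<close>, and the
      trivial component determines the mass after the step. For the indicator this mass is explicit.\<close>
    let ?I = "\<lambda>x. complex_of_real (if coset x = ?b then 1 else 0)"
    obtain y where y: "y \<in> carrier G" "coset y = ?c" using bs(2) by (auto simp: LCOSETS_def)
    have same: "of_nat (card H) * coset_coeff (?U t bs) x triv = of_real (?p t) * coset_coeff ?I x triv"
      if x: "x \<in> carrier G" for x
    proof (cases "coset x = ?b")
      case True
      thus ?thesis using coset_coeff_path_law_triv[OF mc x, of bs t] True coset_coeff_indicator[OF x triv_char, of ?b 1]
        by simp
    next
      case False
      thus ?thesis using coset_coeff_path_law_outside[OF x, of bs t] False coset_coeff_indicator[OF x triv_char, of ?b 1]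
        by simp
    qed
    let ?D = "\<lambda>x. double_coeff ?v triv triv (inv x \<otimes> y)"
    have "of_nat (card H) * (of_nat (card H) ^ 2 * coset_coeff (conv (?U t bs) ?v) y triv)
        = (\<Sum>x\<in>carrier G. of_nat (card H) * coset_coeff (?U t bs) x triv * ?D x)"
      by (subst coset_mass_conv[OF y(1) vanish]) (simp_all add: sum_distrib_left mult.assoc)
    also have "\<dots> = (\<Sum>x\<in>carrier G. of_real (?p t) * coset_coeff ?I x triv * ?D x)"
      by (intro sum.cong refl) (simp only: same)
    also have "\<dots> = of_real (?p t) * (of_nat (card H) ^ 2 * coset_coeff (conv ?I ?v) y triv)"
      by (subst coset_mass_conv[OF y(1)])
         (use coset_coeff_indicator[of _ _ ?b 1] in \<open>simp_all add: sum_distrib_left mult.assoc\<close>)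
    finally have eq: "of_nat (card H) * coset_coeff (conv (?U t bs) ?v) y triv
        = of_real (?p t) * coset_coeff (conv ?I ?v) y triv"
      using card_H_pos by simp
    have "coset_coeff (conv ?I ?v) y triv
        = (\<Sum>k\<in>H. of_real ?s * of_real (\<Sum>x\<in>carrier G. (if coset x = ?b then 1 else 0) * walk_step G w x (y \<otimes> k)))"
      unfolding coset_coeff_def
      by (intro sum.cong refl, subst conv_weight_vec[OF weight]) (use y in auto)
    also have "\<dots> = of_real ?s * of_real (\<Sum>y\<in>coset y. \<Sum>x\<in>carrier G. (if coset x = ?b then 1 else 0) * walk_step G w x y)"
      by (subst sum_coset[OF y(1)]) (simp only: of_real_sum sum_distrib_left)
    also have "(\<Sum>y\<in>coset y. \<Sum>x\<in>carrier G. (if coset x = ?b then 1 else 0) * walk_step G w x y)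
        = (\<Sum>y\<in>?c. \<Sum>x\<in>?b. walk_step G w x y)"
    proof (rule sum.cong)
      show "(\<Sum>x\<in>carrier G. (if coset x = ?b then 1 else 0) * walk_step G w x y') = (\<Sum>x\<in>?b. walk_step G w x y')" for y'
      proof -
        have "(\<Sum>x\<in>carrier G. (if coset x = ?b then 1 else 0) * walk_step G w x y')
            = (\<Sum>x\<in>carrier G. if x \<in> ?b then walk_step G w x y' else 0)"
          by (intro sum.cong refl) (simp add: in_lcoset_iff[OF bs(1)])
        thus ?thesis using coset_subset[OF bs(1)] finite_carrier
          by (simp add: sum.inter_restrict[symmetric] Int_absorb1)
      qed
    qed (simp add: y)
    also have "(\<Sum>y\<in>?c. \<Sum>x\<in>?b. walk_step G w x y) = of_nat (card H) * q ?b ?c"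
      using card_H_pos unfolding q_def by (subst sum.swap) simp
    finally have "of_nat (card H) * coset_coeff (conv (?U t bs) ?v) y triv
        = of_nat (card H) * (of_real ?s * of_real (?p t * q ?b ?c))"
      unfolding eq by (simp del: of_real_sum)
    hence "of_real ?s * complex_of_real (?p (Suc t)) = of_real ?s * of_real (?p t * q ?b ?c)"
      using card_H_pos coset_coeff_path_law_Suc[OF weight mc y(1), of bs t triv]
        coset_coeff_path_law_triv[OF mc y(1), of bs "Suc t"] y(2)
      by (simp del: of_real_sum of_real_mult mult_cancel_left)
    thus ?thesis using s by (simp del: of_real_sum of_real_mult add: of_real_eq_iff)
  qed
  have "markov_chain_with M (lcosets H) q (\<lambda>t \<omega>. coset (X t \<omega>))"
    unfolding markov_chain_with_def
  proof (intro conjI allI impI ballI)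
    show "prob_space M" by (rule prob_space_axioms)
    show "finite (lcosets H)" by simp
    show "(\<lambda>\<omega>. coset (X t \<omega>)) \<in> measurable M (count_space (lcosets H))" for t
      by (rule measurable_compose[OF markov_chainD(3)[OF mc]]) auto
    fix b assume b: "b \<in> lcosets H"
    show "0 \<le> q b c" if c: "c \<in> lcosets H" for c
      unfolding q_def using coset_subset[OF b] coset_subset[OF c]
      by (intro divide_nonneg_nonneg sum_nonneg walk_step_nonneg[OF weight]) auto
    have "(\<Sum>c\<in>lcosets H. q b c) = (\<Sum>x\<in>b. \<Sum>c\<in>lcosets H. \<Sum>y\<in>c. walk_step G w x y) / of_nat (card H)"
      unfolding q_def sum_divide_distrib[symmetric] by (subst sum.swap) simp
    also have "(\<Sum>x\<in>b. \<Sum>c\<in>lcosets H. \<Sum>y\<in>c. walk_step G w x y) = (\<Sum>x\<in>b. 1)"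
      unfolding sum_over_lcosets using coset_subset[OF b] sum_walk_step_right[OF weight] by (intro sum.cong) auto
    finally show "(\<Sum>c\<in>lcosets H. q b c) = 1"
      using l_card_cosets_equal[OF b H_subset finite_carrier] card_H_pos by simp
  next
    fix t bs c assume bs: "\<forall>i\<le>t. bs i \<in> lcosets H" and c: "c \<in> lcosets H"
      and pos: "\<P>(\<omega> in M. \<forall>i\<le>t. coset (X i \<omega>) = bs i) > 0"
    let ?bs = "bs(Suc t := c)"
    have "(\<forall>i\<le>Suc t. coset (X i \<omega>) = ?bs i)
        \<longleftrightarrow> coset (X (Suc t) \<omega>) = c \<and> (\<forall>i\<le>t. coset (X i \<omega>) = bs i)" for \<omega>
      by (auto simp: le_Suc_eq)
    moreover have "(\<forall>i\<le>t. coset (X i \<omega>) = ?bs i) \<longleftrightarrow> (\<forall>i\<le>t. coset (X i \<omega>) = bs i)" for \<omega> by auto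
    ultimately have "\<P>(\<omega> in M. coset (X (Suc t) \<omega>) = c \<and> (\<forall>i\<le>t. coset (X i \<omega>) = bs i))
        = \<P>(\<omega> in M. \<forall>i\<le>t. coset (X i \<omega>) = bs i) * q (bs t) c"
      using step[of ?bs t] bs c by simp
    thus "\<P>(\<omega> in M. coset (X (Suc t) \<omega>) = c \<bar> \<forall>i\<le>t. coset (X i \<omega>) = bs i) = q (bs t) c"
      using pos by (simp add: cond_prob_def)
  qed
  thus ?thesis
    using \<alpha> walk unfolding lumps_weakly_def time_homogeneous_markov_chain_def by blast
qed

end

theorem corollary1p12:
  fixes G :: "('a, 'b) monoid_scheme" and H D :: "'a set" and w :: "'a \<Rightarrow> real"
  assumes "group G" and "finite (carrier G)"
    and "subgroup H G" and "comm_group (G\<lparr>carrier := H\<rparr>)"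
    and "double_coset_reps G H D"
    and "irreducible_weight G w"
  shows "lumps_weakly G H w \<longleftrightarrow>
    (\<exists>P \<subseteq> linear_chars G H. trivial_char H \<in> P \<and>
       weight_vec G w \<in> (\<Inter>x\<in>D. ga_perp G (W_space G H P x)))"
proof -
  interpret group G by fact
  interpret finite_group_abelian_subgroup G H 
    by (intro finite_group_abelian_subgroup.intro finite_group_abelian_subgroup_axioms.intro assms)
  have vec: "weight_vec G w \<in> group_algebra G"
    by (simp add: weight_vec_def group_algebra_def)
  have weight: "weight G w" using assms(6) by (simp add: irreducible_weight_def)
  show ?thesis
  proof
    assume "lumps_weakly G H w"
    thus "\<exists>P \<subseteq> chars. triv \<in> P \<and> weight_vec G w \<in> (\<Inter>x\<in>D. ga_perp G (W_space G H P x))"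
      using lumps_weakly_imp_chars[OF assms(6)] perp_W_space_iff[OF _ assms(5) vec] by meson
  next
    assume "\<exists>P \<subseteq> chars. triv \<in> P \<and> weight_vec G w \<in> (\<Inter>x\<in>D. ga_perp G (W_space G H P x))"
    then obtain P where "P \<subseteq> chars" "triv \<in> P"
      and "weight_vec G w \<in> (\<Inter>x\<in>D. ga_perp G (W_space G H P x))" by blast
    thus "lumps_weakly G H w"
      using perp_W_space_iff[OF _ assms(5) vec] by (intro chars_imp_lumps_weakly[OF weight]) auto
  qed
qed

end
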